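(* Let $X_{1:\infty}=(X_k)_{k\in\mathbb{N}}$ be a random sequence in $(\mathbb{R}^d)^{\mathbb{N}}$. Let $n\in\mathbb{N}$, let $B>0$, and let $\mathcal{F}_{1:n}$ be a set of $n$-tuples $f_{1:n}=(f_1,\dots,f_n)$ of Borel-measurable functions $f_k:\mathbb{R}^d\to[0,B]$ ($k=1,\dots,n$). Assume that $\mathcal{F}_{1:n}$ is pointwise measurable and that $\lambda:\mathbb{N}\times(0,\infty)\to[1,\infty]$ is a uniform entropy estimate of $\mathcal{F}_{1:n}$. Let $(\epsilon,c,\gamma,\gamma')\in(0,1)\times(1,\infty)\times(1,\infty)\times(1,\infty)$ and set $$u_1(c,\gamma'):=\Big(1-\frac1c\Big)\frac1{\gamma'},\qquad u_2(c,\gamma'):=\Big(1-\frac1c\Big)^2\Big(1-\frac1{\gamma'}\Big),$$ $$L_{c,\gamma,\gamma',\epsilon}(k,t):=\frac{2\gamma}{\gamma-1}\exp\Big(-\frac1{2B}u_2(c,\gamma')\,\epsilon\,k\,t+\lambda\Big(k,\frac12u_1(c,\gamma')\,t\Big)\Big),\qquad k\in\{1,\dots,n\},$$ with the convention $L_{c,\gamma,\gamma',\epsilon}(n+1,t):=L_{c,\gamma,\gamma',\epsilon}(n,t)$. Then for every $m\in\{1,\dots,n\}$ and every $$t\ge\frac{Bc}{2}\Big(\frac{\gamma}{\lfloor n/m\rfloor}\Big)^{1/2},$$ we have $$\mathbb{P}\Big(\sup_{f_{1:n}\in\mathcal{F}_{1:n}}\big((1-\epsilon)A_{X_{1:n}}-(1+\epsilon)\mu_{X_{1:n}}\big)f_{1:n}\ge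 t\Big)$$ $$\le\Big[m\max\Big\{L_{c,\gamma,\gamma',\epsilon}\Big(\Big\lfloor\frac nm\Big\rfloor,t\Big),L_{c,\gamma,\gamma',\epsilon}\Big(\Big\lfloor\frac nm\Big\rfloor+1,t\Big)\Big\}+n\beta_{X_{1:\infty}}(m)\Big]\mathbf{1}_{\{t\le2B\}}.$$
   Context: All random variables live on a probability space $(\Omega,\mathcal{E},\mathbb{P})$, which by convention is rich enough to support all the random variables considered. $\mathbb{N}=\{1,2,\dots\}$. For $f_{1:n}=(f_1,\dots,f_n)$, $$A_{X_{1:n}}f_{1:n}:=\frac1n\sum_{k=1}^nf_k(X_k),\qquad\mu_{X_{1:n}}f_{1:n}:=\frac1n\sum_{k=1}^n\int f_k(x)\,\mathbb{P}_{X_k}(dx),$$ where $\mathbb{P}_{X_k}$ is the law of $X_k$, and $(aA_{X_{1:n}}+b\mu_{X_{1:n}})f_{1:n}:=aA_{X_{1:n}}f_{1:n}+b\mu_{X_{1:n}}f_{1:n}$. $\mathcal{F}_{1:n}$ is pointwise measurable if there is a countable family $\{f_{1:n}^{(k)}\}_k\subset\mathcal{F}_{1:n}$ such that for every $f_{1:n}\in\mathcal{F}_{1:n}$ there is a sequence $(k_l)_l$ with $\lim_lf_{1:n}^{(k_l)}=f_{1:n}$ pointwise. Covering numbers: for a nonempty finite $J\subset\{1,\dots,n\}$ let $\mathcal{L}_J$ be the set of all tuples $g_J=(g_j)_{j\in J}$ of Borel functions $g_j:\mathbb{R}^d\to\mathbb{R}$ and let $\mathcal{F}_J:=\{(f_j)_{j\in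 J}:f_{1:n}\in\mathcal{F}_{1:n}\}$. For $z_J=(z_j)_{j\in J}\in(\mathbb{R}^d)^J$ put $d^1_{z_J}(g_J,g_J'):=\frac1{|J|}\sum_{j\in J}|g_j(z_j)-g_j'(z_j)|$. The number $\mathcal{N}_1(r,\mathcal{F}_J,z_J)$ is the minimal cardinality of a set $\mathcal{G}'\subset\mathcal{L}_J$ such that for every $f_J\in\mathcal{F}_J$ there is $g'\in\mathcal{G}'$ with $d^1_{z_J}(f_J,g')<r$. Uniform entropy estimate: a Borel-measurable $\lambda:\mathbb{N}\times(0,\infty)\to[1,\infty]$ is a uniform entropy estimate of $\mathcal{F}_{1:n}$ if for every (nonempty) $J\subset\{1,\dots,n\}$ and every $r\in(0,\infty)$, $$\log\Big(\sup_{z_J\in(\mathbb{R}^d)^J}\mathcal{N}_1(r,\mathcal{F}_J,z_J)\Big)\le\lambda(|J|,r).$$ $\beta$-mixing coefficients: for sub-sigma-algebras $\mathcal{E}_1,\mathcal{E}_2$ of $\mathcal{E}$, $$\beta(\mathcal{E}_1,\mathcal{E}_2):=\mathbb{E}\Big[\operatorname{ess\,sup}_{E_1\in\mathcal{E}_1}|\mathbb{P}(E_1)-\mathbb{P}[E_1|\mathcal{E}_2]|\Big],$$ where $\operatorname{ess\,sup}$ denotes the essential supremum of a family of random variables. For $m\in\mathbb{N}$, $$\beta_{X_{1:\infty}}(m):=\sup_{l\in\mathbb{N}}\beta\big(\sigma(X_k:1\le k\le l-m),\sigma(X_l)\big),$$ where the first sigma-algebra is trivial if $l\le m$. *)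

theory Defs
  imports "HOL-Probability.Probability"
begin

text \<open>
  An \<open>n\<close>-tuple \<open>(f\<^sub>1, \<dots>, f\<^sub>n)\<close> of functions on \<open>\<real>\<^sup>d\<close> is an (extensional) element of
  \<open>\<Pi>\<^sub>E k\<in>{1..n}. \<dots>\<close>; likewise, for \<open>J \<subseteq> {1..n}\<close>, tuples indexed by \<open>J\<close> are extensional on \<open>J\<close>.
  A random sequence \<open>(X\<^sub>k)\<^sub>k\<^sub>\<ge>\<^sub>1\<close> is a function on \<open>nat\<close> whose value at index \<open>0\<close> is never used.
\<close>

definition emp_avg :: "nat \<Rightarrow> (nat \<Rightarrow> 'w \<Rightarrow> 'a) \<Rightarrow> (nat \<Rightarrow> 'a \<Rightarrow> real) \<Rightarrow> 'w \<Rightarrow> real" where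
  "emp_avg n X f \<omega> = (1 / real n) * (\<Sum>k=1..n. f k (X k \<omega>))"

definition mean_avg ::
  "'w measure \<Rightarrow> nat \<Rightarrow> (nat \<Rightarrow> 'w \<Rightarrow> 'a::topological_space) \<Rightarrow> (nat \<Rightarrow> 'a \<Rightarrow> real) \<Rightarrow> real" where
  "mean_avg M n X f = (1 / real n) * (\<Sum>k=1..n. \<integral>x. f k x \<partial>distr M borel (X k))"

definition pointwise_measurable :: "nat \<Rightarrow> (nat \<Rightarrow> 'a \<Rightarrow> real) set \<Rightarrow> bool" where
  "pointwise_measurable n F \<longleftrightarrow>
     (\<exists>C. countable C \<and> C \<subseteq> F \<and>
       (\<forall>f\<in>F. \<exists>s :: nat \<Rightarrow> nat \<Rightarrow> 'a \<Rightarrow> real. (\<forall>l. s l \<in> C) \<and>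
          (\<forall>k\<in>{1..n}. \<forall>x. (\<lambda>l. s l k x) \<longlonglongrightarrow> f k x)))"

definition restrict_class :: "(nat \<Rightarrow> 'b) set \<Rightarrow> nat set \<Rightarrow> (nat \<Rightarrow> 'b) set" where
  "restrict_class F J = (\<lambda>f. restrict f J) ` F"

definition emp_dist1 ::
  "nat set \<Rightarrow> (nat \<Rightarrow> 'a) \<Rightarrow> (nat \<Rightarrow> 'a \<Rightarrow> real) \<Rightarrow> (nat \<Rightarrow> 'a \<Rightarrow> real) \<Rightarrow> real" where
  "emp_dist1 J z g g' = (1 / real (card J)) * (\<Sum>j\<in>J. \<bar>g j (z j) - g' j (z j)\<bar>)"

text \<open>The infimum is \<open>\<infinity>\<close> if there is no finite cover.\<close>

definition covering_number ::
  "nat set \<Rightarrow> real \<Rightarrow> (nat \<Rightarrow> 'a::topological_space \<Rightarrow> real) set \<Rightarrow> (nat \<Rightarrow> 'a) \<Rightarrow> enat" where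
  "covering_number J r FJ z =
     Inf {enat (card G) |G. finite G \<and> G \<subseteq> (\<Pi>\<^sub>E j\<in>J. borel_measurable borel) \<and>
            (\<forall>f\<in>FJ. \<exists>g\<in>G. emp_dist1 J z f g < r)}"

definition ln_enat :: "enat \<Rightarrow> ereal" where
  "ln_enat N = (case N of enat k \<Rightarrow> if k = 0 then -\<infinity> else ereal (ln (real k)) | \<infinity> \<Rightarrow> \<infinity>)"

definition exp_ereal :: "ereal \<Rightarrow> ennreal" where
  "exp_ereal x = (case x of ereal y \<Rightarrow> ennreal (exp y) | PInfty \<Rightarrow> \<infinity> | MInfty \<Rightarrow> 0)"

text \<open>Values of \<open>\<lambda>(k, r)\<close> outside \<open>k \<ge> 1\<close>, \<open>r > 0\<close> are irrelevant.\<close>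

definition uniform_entropy_estimate ::
  "nat \<Rightarrow> (nat \<Rightarrow> 'a::topological_space \<Rightarrow> real) set \<Rightarrow> (nat \<Rightarrow> real \<Rightarrow> ereal) \<Rightarrow> bool" where
  "uniform_entropy_estimate n F lam \<longleftrightarrow>
     (\<lambda>(k, r). lam k r) \<in>
        borel_measurable (count_space {1..} \<Otimes>\<^sub>M restrict_space borel {0<..}) \<and>
     (\<forall>k\<ge>1. \<forall>r>0. 1 \<le> lam k r) \<and>
     (\<forall>J r. J \<noteq> {} \<longrightarrow> J \<subseteq> {1..n} \<longrightarrow> 0 < r \<longrightarrow>
        ln_enat (SUP z \<in> (\<Pi>\<^sub>E j\<in>J. UNIV). covering_number J r (restrict_class F J) z)
          \<le> lam (card J) r)"

text \<open>
  Essential supremum of a (possibly uncountable) family of random variables: the almost surely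
  least measurable function that almost surely dominates every member. On a probability space it
  exists for every family of measurable functions and is unique up to null sets. It is not to be
  confused with the library's \<open>esssup\<close>, the essential supremum of the values of one function.
\<close>

definition is_family_esssup :: "'w measure \<Rightarrow> ('w \<Rightarrow> ennreal) set \<Rightarrow> ('w \<Rightarrow> ennreal) \<Rightarrow> bool" where
  "is_family_esssup M \<Phi> g \<longleftrightarrow>
     g \<in> borel_measurable M \<and> (\<forall>\<phi>\<in>\<Phi>. AE \<omega> in M. \<phi> \<omega> \<le> g \<omega>) \<and>
     (\<forall>h\<in>borel_measurable M. (\<forall>\<phi>\<in>\<Phi>. AE \<omega> in M. \<phi> \<omega> \<le> h \<omega>) \<longrightarrow> (AE \<omega> in M. g \<omega> \<le> h \<omega>))"

definition family_esssup :: "'w measure \<Rightarrow> ('w \<Rightarrow> ennreal) set \<Rightarrow> 'w \<Rightarrow> ennreal" where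
  "family_esssup M \<Phi> = (SOME g. is_family_esssup M \<Phi> g)"

text \<open>
  As for \<open>real_cond_exp\<close>, sub-sigma-algebras are given as measures on \<open>space M\<close> of which only the
  measurable sets matter.
\<close>

definition beta_mixing :: "'w measure \<Rightarrow> 'w measure \<Rightarrow> 'w measure \<Rightarrow> ennreal" where
  "beta_mixing M E\<^sub>1 E\<^sub>2 =
     (\<integral>\<^sup>+\<omega>. family_esssup M
        {\<lambda>\<omega>. ennreal \<bar>measure M A - real_cond_exp M E\<^sub>2 (indicator A) \<omega>\<bar> |A. A \<in> sets E\<^sub>1} \<omega> \<partial>M)"

definition generated_sigma ::
  "'w measure \<Rightarrow> (nat \<Rightarrow> 'w \<Rightarrow> 'a::topological_space) \<Rightarrow> nat set \<Rightarrow> 'w measure" where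
  "generated_sigma M X I =
     sigma (space M) {X k -` A \<inter> space M |k A. k \<in> I \<and> A \<in> sets borel}"

text \<open>For \<open>l \<le> m\<close> truncated subtraction makes the index set \<open>{1..l - m}\<close> empty.\<close>

definition beta_coeff ::
  "'w measure \<Rightarrow> (nat \<Rightarrow> 'w \<Rightarrow> 'a::topological_space) \<Rightarrow> nat \<Rightarrow> ennreal" where
  "beta_coeff M X m =
     (SUP l\<in>{1..}. beta_mixing M (generated_sigma M X {1..l - m}) (generated_sigma M X {l}))"

definition u1 :: "real \<Rightarrow> real \<Rightarrow> real" where
  "u1 c \<gamma>' = (1 - 1 / c) * (1 / \<gamma>')"

definition u2 :: "real \<Rightarrow> real \<Rightarrow> real" where
  "u2 c \<gamma>' = (1 - 1 / c)\<^sup>2 * (1 - 1 / \<gamma>')"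

text \<open>The index \<open>k'\<close> implements the convention \<open>L(n + 1, t) = L(n, t)\<close>.\<close>

definition L_bound ::
  "nat \<Rightarrow> real \<Rightarrow> (nat \<Rightarrow> real \<Rightarrow> ereal) \<Rightarrow> real \<Rightarrow> real \<Rightarrow> real \<Rightarrow> real \<Rightarrow> nat \<Rightarrow> real \<Rightarrow> ennreal" where
  "L_bound n B lam c \<gamma> \<gamma>' \<epsilon> k t =
     (let k' = (if k = n + 1 then n else k) in
       ennreal (2 * \<gamma> / (\<gamma> - 1)) *
       exp_ereal (ereal (- (1 / (2 * B)) * u2 c \<gamma>' * \<epsilon> * real k' * t)
                    + lam k' (1 / 2 * u1 c \<gamma>' * t)))"

end

theory Submission
  imports Defs
begin

text \<open>
  The index set \<open>{1..n}\<close> is split into the \<open>m\<close> residue classes modulo \<open>m\<close>. Within a class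
  consecutive indices are at least \<open>m\<close> apart, so the joint law of a class of size \<open>N\<close> exceeds the
  product of its marginals by at most \<open>N \<beta>(m)\<close>; for two variables this is checked on sets that are
  unions of rectangles over a countable partition of the range of the later variable, where the essential
  supremum bounds all pieces simultaneously, and then extended by approximation.

  For independent samples put \<open>a = 1 - 1/c\<close> and \<open>e = a \<epsilon>\<close>. If \<open>A\<^sub>X f - \<mu> f \<ge> t + \<epsilon> (A\<^sub>X f + \<mu> f)\<close> and
  a ghost sample \<open>Y\<close> satisfies \<open>A\<^sub>Y f \<le> \<mu> f + t/c\<close>, then
  \<open>A\<^sub>X f - A\<^sub>Y f \<ge> a t + e (A\<^sub>X f + A\<^sub>Y f)\<close>; by Hoeffding's inequality the condition on \<open>Y\<close> has
  probability at least \<open>1 - 1/\<gamma>\<close>. Exchanging coordinates of \<open>X\<close> and \<open>Y\<close> at random introduces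
  signs, and for \<open>f, g \<ge> 0\<close> the one-sided inequality
  \<open>(\<sigma> - e) f \<le> \<bar>f - g\<bar> + ((1 - e/2) \<sigma> - e/2) g\<close> for \<open>\<sigma> = \<plusminus>1\<close> allows one to pass to a cover while
  losing exactly its radius. The remaining signed sums have nonpositive drift, and Chernoff's bound
  with parameter \<open>e/B\<close> gives the exponential factor.
\<close>

section \<open>Essential suprema and the mixing coefficient\<close>

text \<open>An uncountable pointwise supremum need not be measurable. Countable subfamilies do have
  measurable suprema, and the union of an integral-maximizing sequence of them gives a countable
  \<open>D\<close> of maximal finite integral. Adjoining a further member cannot raise that
  integral, so \<open>S D\<close> dominates the member almost everywhere.\<close>

lemma exists_family_esssup:
  assumes M: "finite_measure M"
    and meas: "\<And>\<phi>. \<phi> \<in> \<Phi> \<Longrightarrow> \<phi> \<in> borel_measurable M"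
    and bound: "\<And>\<phi>. \<phi> \<in> \<Phi> \<Longrightarrow> AE \<omega> in M. \<phi> \<omega> \<le> 1"
  shows "\<exists>g. is_family_esssup M \<Phi> g"
proof -
  interpret finite_measure M by fact
  define S where "S C \<omega> = (SUP \<phi>\<in>C. \<phi> \<omega>)" for C :: "('a \<Rightarrow> ennreal) set" and \<omega>
  define CC where "CC = {C. countable C \<and> C \<subseteq> \<Phi>}"
  have S_meas[measurable]: "S C \<in> borel_measurable M" if "C \<in> CC" for C
    using that meas unfolding S_def CC_def by (auto intro!: borel_measurable_SUP)
  have S_le: "(\<integral>\<^sup>+\<omega>. S C \<omega> \<partial>M) \<le> emeasure M (space M)" if C: "C \<in> CC" for C
  proof -
    have "AE \<omega> in M. \<forall>\<phi>\<in>C. \<phi> \<omega> \<le> 1"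
      using C bound unfolding CC_def by (auto simp: AE_ball_countable)
    then have "AE \<omega> in M. S C \<omega> \<le> 1"
      by eventually_elim (auto simp: S_def intro!: SUP_least)
    then have "(\<integral>\<^sup>+\<omega>. S C \<omega> \<partial>M) \<le> (\<integral>\<^sup>+\<omega>. 1 \<partial>M)" by (rule nn_integral_mono_AE)
    then show ?thesis by simp
  qed
  have "CC \<noteq> {}" unfolding CC_def by auto
  from ennreal_SUP_countable_SUP[OF this, of "\<lambda>C. \<integral>\<^sup>+\<omega>. S C \<omega> \<partial>M"]
  obtain s :: "nat \<Rightarrow> ennreal" where s: "range s \<subseteq> (\<lambda>C. \<integral>\<^sup>+\<omega>. S C \<omega> \<partial>M) ` CC"
    and sup: "(SUP C\<in>CC. \<integral>\<^sup>+\<omega>. S C \<omega> \<partial>M) = (SUP i. s i)" by auto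
  from s have "\<forall>i. \<exists>C. C \<in> CC \<and> s i = (\<integral>\<^sup>+\<omega>. S C \<omega> \<partial>M)" by blast
  then obtain C where C: "\<And>i. C i \<in> CC" "\<And>i. s i = (\<integral>\<^sup>+\<omega>. S (C i) \<omega> \<partial>M)" by metis
  define D where "D = (\<Union>i. C i)"
  have D: "D \<in> CC" using C(1) unfolding CC_def D_def by auto
  have D_max: "(\<integral>\<^sup>+\<omega>. S E \<omega> \<partial>M) \<le> (\<integral>\<^sup>+\<omega>. S D \<omega> \<partial>M)" if E: "E \<in> CC" for E
  proof -
    have "s i \<le> (\<integral>\<^sup>+\<omega>. S D \<omega> \<partial>M)" for i
      unfolding C(2) S_def D_def by (intro nn_integral_mono SUP_subset_mono) auto
    then have "(SUP i. s i) \<le> (\<integral>\<^sup>+\<omega>. S D \<omega> \<partial>M)" by (rule SUP_least)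
    then show ?thesis using SUP_upper[OF E, of "\<lambda>C. \<integral>\<^sup>+\<omega>. S C \<omega> \<partial>M"] sup by simp
  qed
  have dom: "AE \<omega> in M. \<phi> \<omega> \<le> S D \<omega>" if \<phi>: "\<phi> \<in> \<Phi>" for \<phi>
  proof -
    have E: "insert \<phi> D \<in> CC" using D \<phi> unfolding CC_def by auto
    note [measurable] = S_meas[OF D] S_meas[OF E]
    have mono: "S D \<omega> \<le> S (insert \<phi> D) \<omega>" for \<omega> unfolding S_def by (intro SUP_subset_mono) auto
    have fin: "(\<integral>\<^sup>+\<omega>. S D \<omega> \<partial>M) \<noteq> \<infinity>"
      using S_le[OF D] by (metis emeasure_finite infinity_ennreal_def neq_top_trans)
    have "(\<integral>\<^sup>+\<omega>. S (insert \<phi> D) \<omega> - S D \<omega> \<partial>M)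
        = (\<integral>\<^sup>+\<omega>. S (insert \<phi> D) \<omega> \<partial>M) - (\<integral>\<^sup>+\<omega>. S D \<omega> \<partial>M)"
      by (intro nn_integral_diff) (use fin mono in auto)
    also have "\<dots> = 0"
      using D_max[OF E] fin by (subst diff_eq_0_iff_ennreal) (auto simp: top.not_eq_extremum intro: le_less_trans)
    finally have "AE \<omega> in M. S (insert \<phi> D) \<omega> - S D \<omega> = 0"
      by (subst (asm) nn_integral_0_iff_AE) auto
    moreover have "AE \<omega> in M. S D \<omega> \<noteq> \<infinity>" using fin by (intro nn_integral_noteq_infinite) auto
    ultimately show ?thesis
    proof eventually_elim
      case (elim \<omega>)
      then have "S (insert \<phi> D) \<omega> \<le> S D \<omega>" by (auto simp: diff_eq_0_iff_ennreal)
      moreover have "\<phi> \<omega> \<le> S (insert \<phi> D) \<omega>" unfolding S_def by (intro SUP_upper) auto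
      ultimately show ?case by simp
    qed
  qed
  have "AE \<omega> in M. S D \<omega> \<le> h \<omega>"
    if "\<forall>\<phi>\<in>\<Phi>. AE \<omega> in M. \<phi> \<omega> \<le> h \<omega>" for h
  proof -
    have "AE \<omega> in M. \<forall>\<phi>\<in>D. \<phi> \<omega> \<le> h \<omega>"
      using D that unfolding CC_def by (auto simp: AE_ball_countable)
    then show ?thesis by eventually_elim (auto simp: S_def intro!: SUP_least)
  qed
  then show ?thesis unfolding is_family_esssup_def using dom S_meas[OF D] by blast
qed

text \<open>This trades the choice in \<open>family_esssup\<close> for a concrete majorant. Almost
  everywhere the conditional probability of \<open>A\<close> is at most
  \<open>emeasure M A + g\<close>; integrating over \<open>D\<close> gives the inequality. The error
  stays local to \<open>D\<close> and \<open>g\<close> is the same for all \<open>A\<close>, so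
  disjoint sets \<open>D\<close> share one budget.\<close>

lemma beta_mixing_dominating:
  assumes "prob_space M" and E1: "sets E1 \<subseteq> sets M" and E2: "subalgebra M E2"
  obtains g where "g \<in> borel_measurable M"
    and "beta_mixing M E1 E2 = (\<integral>\<^sup>+\<omega>. g \<omega> \<partial>M)"
    and "\<And>A D. A \<in> sets E1 \<Longrightarrow> D \<in> sets E2 \<Longrightarrow>
      emeasure M (A \<inter> D) \<le> emeasure M A * emeasure M D + (\<integral>\<^sup>+\<omega>. g \<omega> * indicator D \<omega> \<partial>M)"
proof -
  interpret prob_space M by fact
  interpret finite_measure_subalgebra M E2 by unfold_locales fact
  define \<Phi> where "\<Phi> = {\<lambda>\<omega>. ennreal \<bar>measure M A - real_cond_exp M E2 (indicator A) \<omega>\<bar> |A. A \<in> sets E1}"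
  have int: "integrable M (indicator A :: _ \<Rightarrow> real)" if "A \<in> sets M" for A
    using that by (simp add: integrable_indicator_iff emeasure_finite top.not_eq_extremum[symmetric])
  have pos: "AE \<omega> in M. real_cond_exp M E2 (indicator A) \<omega> \<ge> 0" if "A \<in> sets M" for A
    by (rule real_cond_exp_pos) (use that in auto)
  have "\<exists>g. is_family_esssup M \<Phi> g"
  proof (rule exists_family_esssup)
    show "finite_measure M" by unfold_locales
  next
    fix \<phi> assume "\<phi> \<in> \<Phi>"
    then show "\<phi> \<in> borel_measurable M" unfolding \<Phi>_def by auto
  next
    fix \<phi> assume "\<phi> \<in> \<Phi>"
    then obtain A where A: "A \<in> sets E1"
      and \<phi>: "\<phi> = (\<lambda>\<omega>. ennreal \<bar>measure M A - real_cond_exp M E2 (indicator A) \<omega>\<bar>)"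
      unfolding \<Phi>_def by auto
    have A': "A \<in> sets M" using A E1 by auto
    have "AE \<omega> in M. real_cond_exp M E2 (indicator A) \<omega> \<le> 1"
      by (rule real_cond_exp_le_c[OF int[OF A']]) (auto simp: indicator_def)
    with pos[OF A'] show "AE \<omega> in M. \<phi> \<omega> \<le> 1"
    proof eventually_elim
      case (elim \<omega>)
      then have "\<bar>measure M A - real_cond_exp M E2 (indicator A) \<omega>\<bar> \<le> 1"
        using measure_nonneg[of M A] prob_le_1[of A] by linarith
      then show ?case unfolding \<phi> by (metis ennreal_1 ennreal_leI)
    qed
  qed
  \<comment> \<open>The choice is meaningful because the members of \<open>\<Phi>\<close> lie
    between 0 and 1 almost everywhere.\<close>
  then have g: "is_family_esssup M \<Phi> (family_esssup M \<Phi>)"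
    unfolding family_esssup_def by (rule someI_ex)
  define g where "g = family_esssup M \<Phi>"
  have g_meas[measurable]: "g \<in> borel_measurable M"
    using g unfolding is_family_esssup_def g_def by auto
  show thesis
  proof (rule that[OF g_meas])
    show "beta_mixing M E1 E2 = (\<integral>\<^sup>+\<omega>. g \<omega> \<partial>M)"
      unfolding beta_mixing_def \<Phi>_def g_def ..
    fix A D assume A: "A \<in> sets E1" and D: "D \<in> sets E2"
    have A'[measurable]: "A \<in> sets M" using A E1 by auto
    have D'[measurable]: "D \<in> sets M" using D E2 unfolding subalgebra_def by auto
    let ?c = "real_cond_exp M E2 (indicator A)"
    have "(\<lambda>\<omega>. ennreal \<bar>measure M A - ?c \<omega>\<bar>) \<in> \<Phi>" using A unfolding \<Phi>_def by blast
    then have "AE \<omega> in M. ennreal \<bar>measure M A - ?c \<omega>\<bar> \<le> g \<omega>"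
      using g unfolding is_family_esssup_def g_def by fast
    then have le: "AE \<omega> in M. ennreal (?c \<omega>) \<le> emeasure M A + g \<omega>"
    proof eventually_elim
      case (elim \<omega>)
      have "ennreal (?c \<omega>) \<le> ennreal (measure M A + \<bar>measure M A - ?c \<omega>\<bar>)"
        by (intro ennreal_leI) linarith
      also have "\<dots> = emeasure M A + ennreal \<bar>measure M A - ?c \<omega>\<bar>"
        by (simp add: emeasure_eq_measure)
      also have "\<dots> \<le> emeasure M A + g \<omega>" using elim by (intro add_left_mono)
      finally show ?case .
    qed
    have ci: "integrable M ?c" by (rule real_cond_exp_int(1)[OF int[OF A']])
    have "measure M (A \<inter> D) = (\<integral>\<omega>\<in>D. indicator A \<omega> \<partial>M)"
      by (simp add: set_lebesgue_integral_def flip: indicator_inter_arith) (simp add: Int_commute)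
    also have "\<dots> = (\<integral>\<omega>\<in>D. ?c \<omega> \<partial>M)" by (rule real_cond_exp_intA[OF int[OF A'] D])
    finally have "emeasure M (A \<inter> D) = ennreal (\<integral>\<omega>\<in>D. ?c \<omega> \<partial>M)"
      by (simp add: emeasure_eq_measure)
    also have "\<dots> = (\<integral>\<^sup>+\<omega>. ennreal (indicator D \<omega> * ?c \<omega>) \<partial>M)"
      unfolding set_lebesgue_integral_def
      by (subst nn_integral_eq_integral)
         (use pos[OF A'] integrable_mult_indicator[OF D' ci] in \<open>auto elim!: eventually_mono simp: indicator_def\<close>)
    also have "\<dots> \<le> (\<integral>\<^sup>+\<omega>. emeasure M A * indicator D \<omega> + g \<omega> * indicator D \<omega> \<partial>M)"
      using le by (intro nn_integral_mono_AE) (auto elim!: eventually_mono split: split_indicator)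
    also have "\<dots> = emeasure M A * emeasure M D + (\<integral>\<^sup>+\<omega>. g \<omega> * indicator D \<omega> \<partial>M)"
      by (subst nn_integral_add) (auto simp: nn_integral_cmult_indicator)
    finally show "emeasure M (A \<inter> D) \<le> \<dots>" .
  qed
qed

text \<open>The sets that can be approximated within every \<open>e\<close> are closed under
  complements and countable unions. Both measures enter one error term because the same
  \<open>R\<close> has to serve them simultaneously.\<close>

lemma sigma_sets_approx_by_algebra:
  assumes "finite_measure \<mu>" "finite_measure \<nu>"
    and alg: "algebra \<Omega> \<A>"
    and sets_\<mu>: "sets \<mu> = sigma_sets \<Omega> \<A>" and sets_\<nu>: "sets \<nu> = sigma_sets \<Omega> \<A>"
    and Q: "Q \<in> sigma_sets \<Omega> \<A>" and e: "(0::real) < e"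
  shows "\<exists>R\<in>\<A>. measure \<mu> (sym_diff Q R) + measure \<nu> (sym_diff Q R) < e"
proof -
  interpret \<mu>: finite_measure \<mu> by fact
  interpret \<nu>: finite_measure \<nu> by fact
  interpret algebra \<Omega> \<A> by fact
  define D where "D Q R = measure \<mu> (sym_diff Q R) + measure \<nu> (sym_diff Q R)" for Q R
  have in_\<mu>: "A \<in> sets \<mu>" and in_\<nu>: "A \<in> sets \<nu>" if "A \<in> sigma_sets \<Omega> \<A>" for A
    using that sets_\<mu> sets_\<nu> by auto
  \<comment> \<open>Used twice: for the union of two sets, and as the triangle inequality of the
    pseudometric \<open>D\<close>.\<close>
  have sub: "D A B \<le> D A' B' + D A'' B''"
    if "sym_diff A B \<subseteq> sym_diff A' B' \<union> sym_diff A'' B''"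
      and "A' \<in> sets \<mu>" "B' \<in> sets \<mu>" "A'' \<in> sets \<mu>" "B'' \<in> sets \<mu>" for A B A' B' A'' B''
  proof -
    have *: "measure \<rho> (sym_diff A B) \<le> measure \<rho> (sym_diff A' B') + measure \<rho> (sym_diff A'' B'')"
      if "finite_measure \<rho>" "sets \<rho> = sets \<mu>" for \<rho>
    proof -
      interpret \<rho>: finite_measure \<rho> by fact
      note s = \<open>A' \<in> sets \<mu>\<close> \<open>B' \<in> sets \<mu>\<close> \<open>A'' \<in> sets \<mu>\<close> \<open>B'' \<in> sets \<mu>\<close>
      have "measure \<rho> (sym_diff A B) \<le> measure \<rho> (sym_diff A' B' \<union> sym_diff A'' B'')"
        by (rule \<rho>.finite_measure_mono) (use that s \<open>sym_diff A B \<subseteq> _\<close> in auto)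
      also have "\<dots> \<le> measure \<rho> (sym_diff A' B') + measure \<rho> (sym_diff A'' B'')"
        by (rule measure_Un_le) (use that s in auto)
      finally show ?thesis .
    qed
    show ?thesis unfolding D_def
      using *[OF \<open>finite_measure \<mu>\<close>] *[OF \<open>finite_measure \<nu>\<close>] sets_\<mu> sets_\<nu> by auto
  qed
  have "\<exists>R\<in>\<A>. D Q R < e" if "0 < e" for e
    using Q that
  proof (induction arbitrary: e rule: sigma_sets.induct)
    case (Basic a)
    then show ?case by (intro bexI[of _ a]) (auto simp: D_def)
  next
    case Empty
    then show ?case by (intro bexI[of _ "{}"]) (auto simp: D_def)
  next
    case (Compl a)
    then obtain R where R: "R \<in> \<A>" "D a R < e" by blast
    have "a \<subseteq> \<Omega>" "R \<subseteq> \<Omega>"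
      using Compl(1) R(1) space_closed sigma_sets_into_sp[of \<A> \<Omega>] by auto
    then have "sym_diff (\<Omega> - a) (\<Omega> - R) = sym_diff a R" by auto
    then show ?case using R by (intro bexI[of _ "\<Omega> - R"]) (auto simp: D_def)
  next
    case (Union a)
    let ?V = "\<lambda>k::nat. \<Union>i<k. a i"
    have V: "?V k \<in> sigma_sets \<Omega> \<A>" for k
    proof -
      have "?V k \<in> sets \<mu>" using Union(1) sets_\<mu> by (intro sets.finite_UN) auto
      then show ?thesis using sets_\<mu> by simp
    qed
    have U: "(\<Union>i. a i) \<in> sigma_sets \<Omega> \<A>" using Union(1) by (rule sigma_sets.Union)
    have fin: "\<exists>R\<in>\<A>. D (?V k) R < d" if "d > 0" for d k
      using that
    proof (induction k arbitrary: d)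
      case 0
      then show ?case by (intro bexI[of _ "{}"]) (auto simp: D_def)
    next
      case (Suc k)
      obtain R where R: "R \<in> \<A>" "D (?V k) R < d/2" using Suc.IH[of "d/2"] Suc.prems by auto
      obtain R' where R': "R' \<in> \<A>" "D (a k) R' < d/2" using Union.IH[of "d/2" k] Suc.prems by auto
      have "D (?V (Suc k)) (R \<union> R') \<le> D (?V k) R + D (a k) R'"
        by (rule sub) (use V R R' Union(1) in_\<mu> in \<open>auto simp: less_Suc_eq\<close>)
      then show ?case using R R' by (intro bexI[of _ "R \<union> R'"]) auto
    qed
    \<comment> \<open>Continuity of measure makes what finitely many \<open>a i\<close> leave out of
      the union small, which reduces countable to finite unions.\<close>
    have lim: "(\<lambda>k. measure \<rho> ((\<Union>i. a i) - ?V k)) \<longlonglongrightarrow> 0"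
      if "finite_measure \<rho>" "sets \<rho> = sigma_sets \<Omega> \<A>" for \<rho>
    proof -
      interpret \<rho>: finite_measure \<rho> by fact
      have inc: "incseq ?V" unfolding incseq_def by (intro allI impI UN_mono) auto
      have UV: "(\<Union>k. ?V k) = (\<Union>i. a i)" by auto
      have "(\<lambda>k. measure \<rho> (?V k)) \<longlonglongrightarrow> measure \<rho> (\<Union>k. ?V k)"
        by (rule \<rho>.finite_Lim_measure_incseq) (use V that inc in auto)
      then have "(\<lambda>k. measure \<rho> (\<Union>i. a i) - measure \<rho> (?V k)) \<longlonglongrightarrow> measure \<rho> (\<Union>i. a i) - measure \<rho> (\<Union>i. a i)"
        unfolding UV by (intro tendsto_intros)
      moreover have "measure \<rho> ((\<Union>i. a i) - ?V k) = measure \<rho> (\<Union>i. a i) - measure \<rho> (?V k)" for k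
        by (rule \<rho>.finite_measure_Diff) (use U V that in auto)
      ultimately show ?thesis by simp
    qed
    have "(\<lambda>k. measure \<mu> ((\<Union>i. a i) - ?V k) + measure \<nu> ((\<Union>i. a i) - ?V k)) \<longlonglongrightarrow> 0 + 0"
      by (intro tendsto_add lim) (use assms in auto)
    then have "eventually (\<lambda>k. measure \<mu> ((\<Union>i. a i) - ?V k) + measure \<nu> ((\<Union>i. a i) - ?V k) < e/2) sequentially"
      using \<open>e > 0\<close> by (auto dest: order_tendstoD(2)[of _ _ _ "e/2"])
    then obtain k where k: "measure \<mu> ((\<Union>i. a i) - ?V k) + measure \<nu> ((\<Union>i. a i) - ?V k) < e/2"
      by (auto simp: eventually_sequentially)
    have "sym_diff (\<Union>i. a i) (?V k) = (\<Union>i. a i) - ?V k" by auto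
    then have k: "D (\<Union>i. a i) (?V k) < e/2" using k by (simp add: D_def)
    obtain R where R: "R \<in> \<A>" "D (?V k) R < e/2" using fin[of "e/2" k] \<open>e > 0\<close> by auto
    have "D (\<Union>i. a i) R \<le> D (\<Union>i. a i) (?V k) + D (?V k) R"
      by (rule sub) (use V U R in_\<mu> in auto)
    with k R show ?case by (intro bexI[of _ R]) auto
  qed
  then show ?thesis using e by (simp add: D_def)
qed

text \<open>Passing from \<open>Q\<close> to a close \<open>R\<close> of the algebra and back costs
  the symmetric difference once under each measure. The constant \<open>b\<close> does not depend on
  the set, so it survives the limit unchanged, even if it is infinite.\<close>

lemma emeasure_le_of_algebra:
  assumes "finite_measure \<mu>" "finite_measure \<nu>"
    and alg: "algebra \<Omega> \<A>"
    and sets_\<mu>: "sets \<mu> = sigma_sets \<Omega> \<A>" and sets_\<nu>: "sets \<nu> = sigma_sets \<Omega> \<A>"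
    and le: "\<And>R. R \<in> \<A> \<Longrightarrow> emeasure \<mu> R \<le> emeasure \<nu> R + b"
    and Q: "Q \<in> sigma_sets \<Omega> \<A>"
  shows "emeasure \<mu> Q \<le> emeasure \<nu> Q + b"
proof (rule ennreal_le_epsilon)
  fix e :: real assume "0 < e"
  interpret \<mu>: finite_measure \<mu> by fact
  interpret \<nu>: finite_measure \<nu> by fact
  obtain R where R: "R \<in> \<A>" and d: "measure \<mu> (sym_diff Q R) + measure \<nu> (sym_diff Q R) < e"
    using sigma_sets_approx_by_algebra[OF assms(1-5) Q \<open>0 < e\<close>] by auto
  have R': "R \<in> sigma_sets \<Omega> \<A>" using R by auto
  have "emeasure \<mu> Q \<le> emeasure \<mu> (R \<union> sym_diff Q R)"
    by (rule emeasure_mono) (use Q R' sets_\<mu> in auto)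
  also have "\<dots> \<le> emeasure \<mu> R + emeasure \<mu> (sym_diff Q R)"
    by (rule emeasure_subadditive) (use Q R' sets_\<mu> in auto)
  also have "emeasure \<mu> R \<le> emeasure \<nu> R + b" by (rule le) fact
  also have "emeasure \<nu> R \<le> emeasure \<nu> (Q \<union> sym_diff Q R)"
    by (rule emeasure_mono) (use Q R' sets_\<nu> in auto)
  also have "\<dots> \<le> emeasure \<nu> Q + emeasure \<nu> (sym_diff Q R)"
    by (rule emeasure_subadditive) (use Q R' sets_\<nu> in auto)
  finally have "emeasure \<mu> Q \<le> emeasure \<nu> Q + b
      + (emeasure \<mu> (sym_diff Q R) + emeasure \<nu> (sym_diff Q R))"
    by (simp add: ac_simps add_right_mono)
  also have "emeasure \<mu> (sym_diff Q R) + emeasure \<nu> (sym_diff Q R) \<le> ennreal e"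
    using d by (simp add: \<mu>.emeasure_eq_measure \<nu>.emeasure_eq_measure ennreal_leI flip: ennreal_plus)
  finally show "emeasure \<mu> Q \<le> emeasure \<nu> Q + b + ennreal e" by (simp add: add_left_mono)
qed

section \<open>Sliced sets and the joint law of two variables\<close>

text \<open>
  The algebra of sets \<open>{(z, y). y \<in> A (h z)}\<close> with \<open>h\<close> countably valued avoids refining finite
  unions of rectangles to have pairwise disjoint first factors.
\<close>

definition sliced_sets :: "'b measure \<Rightarrow> 'c measure \<Rightarrow> ('b \<times> 'c) set set" where
  "sliced_sets N1 N2 = {{(z, y). z \<in> space N1 \<and> y \<in> A (h z)} |h A.
     h \<in> measurable N1 (count_space (UNIV :: nat set)) \<and> (\<forall>i. A i \<in> sets N2)}"

lemma sliced_setsI: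
  assumes "h \<in> measurable N1 (count_space (UNIV :: nat set))" "\<And>i. A i \<in> sets N2"
    and "R = {(z, y). z \<in> space N1 \<and> y \<in> A (h z)}"
  shows "R \<in> sliced_sets N1 N2"
  unfolding sliced_sets_def mem_Collect_eq using assms by (intro exI[of _ h] exI[of _ A]) simp

lemma sliced_setsD:
  assumes "R \<in> sliced_sets N1 N2"
  shows "\<exists>h A. R = {(z, y). z \<in> space N1 \<and> y \<in> A (h z)} \<and>
    h \<in> measurable N1 (count_space (UNIV :: nat set)) \<and> (\<forall>i. A i \<in> sets N2)"
  using assms unfolding sliced_sets_def mem_Collect_eq .

lemma algebra_sliced_sets: "algebra (space N1 \<times> space N2) (sliced_sets N1 N2)"
proof (unfold algebra_iff_Un, intro conjI ballI)
  show "sliced_sets N1 N2 \<subseteq> Pow (space N1 \<times> space N2)"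
  proof
    fix R assume R_in: "R \<in> sliced_sets N1 N2"
    from sliced_setsD[OF R_in] obtain h and A :: "nat \<Rightarrow> 'b set" where "\<And>i. A i \<in> sets N2" and R: "R = {(z, y). z \<in> space N1 \<and> y \<in> A (h z)}"
      by blast
    then have "A i \<subseteq> space N2" for i by (metis sets.sets_into_space)
    then show "R \<in> Pow (space N1 \<times> space N2)" unfolding R by blast
  qed
  show "{} \<in> sliced_sets N1 N2"
    by (rule sliced_setsI[of "\<lambda>_. 0" _ "\<lambda>_. {}"]) auto
next
  fix R assume R_in: "R \<in> sliced_sets N1 N2"
  from sliced_setsD[OF R_in] obtain h A where h: "h \<in> measurable N1 (count_space (UNIV :: nat set))" and A: "\<And>i. A i \<in> sets N2"
    and R: "R = {(z, y). z \<in> space N1 \<and> y \<in> A (h z)}" by blast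
  show "space N1 \<times> space N2 - R \<in> sliced_sets N1 N2"
    by (rule sliced_setsI[of h _ "\<lambda>i. space N2 - A i"]) (use h A in \<open>auto simp: R\<close>)
next
  fix R R' assume RR: "R \<in> sliced_sets N1 N2" "R' \<in> sliced_sets N1 N2"
  from sliced_setsD[OF RR(1)] sliced_setsD[OF RR(2)] obtain h A h' A'
    where [measurable]: "h \<in> measurable N1 (count_space (UNIV :: nat set))" "h' \<in> measurable N1 (count_space (UNIV :: nat set))"
    and A: "\<And>i. A i \<in> sets N2" "\<And>i. A' i \<in> sets N2"
    and R: "R = {(z, y). z \<in> space N1 \<and> y \<in> A (h z)}" "R' = {(z, y). z \<in> space N1 \<and> y \<in> A' (h' z)}"
    by blast
  show "R \<union> R' \<in> sliced_sets N1 N2"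
  \<comment> \<open>\<open>prod_encode\<close> codes both labels as one natural number, so the union
    again has a single label function.\<close>
  proof (rule sliced_setsI[of "\<lambda>z. prod_encode (h z, h' z)" _ "\<lambda>i. A (fst (prod_decode i)) \<union> A' (snd (prod_decode i))"])
    show "(\<lambda>z. prod_encode (h z, h' z)) \<in> measurable N1 (count_space UNIV)" by measurable
  next
    show "A (fst (prod_decode i)) \<union> A' (snd (prod_decode i)) \<in> sets N2" for i
      by (intro sets.Un A)
    show "R \<union> R' = {(z, y). z \<in> space N1 \<and> y \<in> A (fst (prod_decode (prod_encode (h z, h' z)))) \<union> A' (snd (prod_decode (prod_encode (h z, h' z))))}"
      unfolding R by auto
  qed
qed

lemma sigma_sets_sliced_sets:
  "sigma_sets (space N1 \<times> space N2) (sliced_sets N1 N2) = sets (N1 \<Otimes>\<^sub>M N2)"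
proof
  have "R \<in> sets (N1 \<Otimes>\<^sub>M N2)" if R_in: "R \<in> sliced_sets N1 N2" for R
  proof -
    from sliced_setsD[OF R_in] obtain h A where [measurable]: "h \<in> measurable N1 (count_space (UNIV :: nat set))" "\<And>i. A i \<in> sets N2"
      and R: "R = {(z, y). z \<in> space N1 \<and> y \<in> A (h z)}" by blast
    have "R = (\<Union>i. (h -` {i} \<inter> space N1) \<times> A i)" using R by auto
    also have "\<dots> \<in> sets (N1 \<Otimes>\<^sub>M N2)" by (intro sets.countable_UN) auto
    finally show ?thesis .
  qed
  then show "sigma_sets (space N1 \<times> space N2) (sliced_sets N1 N2) \<subseteq> sets (N1 \<Otimes>\<^sub>M N2)"
    unfolding space_pair_measure[symmetric] by (intro sets.sigma_sets_subset) auto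
  show "sets (N1 \<Otimes>\<^sub>M N2) \<subseteq> sigma_sets (space N1 \<times> space N2) (sliced_sets N1 N2)"
    unfolding sets_pair_measure
  proof (rule sigma_sets_mono', safe)
    fix a b assume ab: "a \<in> sets N1" "b \<in> sets N2"
    show "a \<times> b \<in> sliced_sets N1 N2"
    \<comment> \<open>A rectangle is sliced with two labels: slice \<open>b\<close> over
      \<open>a\<close>, the empty slice elsewhere.\<close>
    proof (rule sliced_setsI[of "\<lambda>z. if z \<in> a then 1 else 0" _ "\<lambda>i. if i = 1 then b else {}"])
      show "(\<lambda>z. if z \<in> a then 1 else 0) \<in> measurable N1 (count_space UNIV)" using ab by measurable
    qed (use ab sets.sets_into_space[OF ab(1)] in \<open>auto split: if_splits\<close>)
  qed
qed

text \<open>On a sliced set the events \<open>D i\<close>, saying that \<open>Z\<close> has label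
  \<open>i\<close>, partition the space. Each piece pays only the integral of \<open>g\<close> over
  \<open>D i\<close>, so all pieces together pay the mixing coefficient once, however many labels
  occur. \<open>Z\<close> belongs to the conditioning sigma-algebra; \<open>Y\<close> supplies the
  events inside the essential supremum.\<close>

lemma joint_law_le_product_add_beta:
  assumes M: "prob_space M" and E1: "sets E1 \<subseteq> sets M" and E2: "subalgebra M E2"
    and Z: "Z \<in> measurable M N1" and Y: "Y \<in> measurable M N2"
    and ZE: "\<And>B. B \<in> sets N1 \<Longrightarrow> Z -` B \<inter> space M \<in> sets E2"
    and YE: "\<And>B. B \<in> sets N2 \<Longrightarrow> Y -` B \<inter> space M \<in> sets E1"
    and Q: "Q \<in> sets (N1 \<Otimes>\<^sub>M N2)"
  shows "emeasure (distr M (N1 \<Otimes>\<^sub>M N2) (\<lambda>\<omega>. (Z \<omega>, Y \<omega>))) Q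
           \<le> emeasure (distr M N1 Z \<Otimes>\<^sub>M distr M N2 Y) Q + beta_mixing M E1 E2"
proof -
  interpret prob_space M by fact
  note [measurable] = Z Y
  interpret Z: prob_space "distr M N1 Z" by (rule prob_space_distr) fact
  interpret Y: prob_space "distr M N2 Y" by (rule prob_space_distr) fact
  interpret ZY: pair_prob_space "distr M N1 Z" "distr M N2 Y" ..
  interpret J: prob_space "distr M (N1 \<Otimes>\<^sub>M N2) (\<lambda>\<omega>. (Z \<omega>, Y \<omega>))" by (rule prob_space_distr) simp
  obtain g where g[measurable]: "g \<in> borel_measurable M"
    and beta: "beta_mixing M E1 E2 = (\<integral>\<^sup>+\<omega>. g \<omega> \<partial>M)"
    and dom: "\<And>A D. A \<in> sets E1 \<Longrightarrow> D \<in> sets E2 \<Longrightarrow>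
      emeasure M (A \<inter> D) \<le> emeasure M A * emeasure M D + (\<integral>\<^sup>+\<omega>. g \<omega> * indicator D \<omega> \<partial>M)"
    using beta_mixing_dominating[OF M E1 E2] by metis
  show ?thesis
  proof (rule emeasure_le_of_algebra[OF _ _ algebra_sliced_sets[of N1 N2]])
    show "finite_measure (distr M (N1 \<Otimes>\<^sub>M N2) (\<lambda>\<omega>. (Z \<omega>, Y \<omega>)))" by unfold_locales
    show "finite_measure (distr M N1 Z \<Otimes>\<^sub>M distr M N2 Y)" by unfold_locales
    show "sets (distr M (N1 \<Otimes>\<^sub>M N2) (\<lambda>\<omega>. (Z \<omega>, Y \<omega>))) = sigma_sets (space N1 \<times> space N2) (sliced_sets N1 N2)"
      by (simp add: sigma_sets_sliced_sets)
    show "sets (distr M N1 Z \<Otimes>\<^sub>M distr M N2 Y) = sigma_sets (space N1 \<times> space N2) (sliced_sets N1 N2)"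
      unfolding sigma_sets_sliced_sets by (intro sets_pair_measure_cong) auto
    show "Q \<in> sigma_sets (space N1 \<times> space N2) (sliced_sets N1 N2)"
      using Q by (simp add: sigma_sets_sliced_sets)
  next
    fix R assume R_in: "R \<in> sliced_sets N1 N2"
    from sliced_setsD[OF R_in] obtain h A where h[measurable]: "h \<in> measurable N1 (count_space (UNIV :: nat set))" and A[measurable]: "\<And>i. A i \<in> sets N2"
      and R: "R = {(z, y). z \<in> space N1 \<and> y \<in> A (h z)}" by blast
    define H where "H i = h -` {i} \<inter> space N1" for i
    have H[measurable]: "H i \<in> sets N1" for i unfolding H_def by measurable
    have RU: "R = (\<Union>i. H i \<times> A i)" unfolding R H_def by auto
    have disj: "disjoint_family (\<lambda>i. H i \<times> A i)" unfolding disjoint_family_on_def H_def by auto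
    define D where "D i = Z -` H i \<inter> space M" for i
    define F where "F i = Y -` A i \<inter> space M" for i
    have DF[measurable]: "D i \<in> sets M" "F i \<in> sets M" for i unfolding D_def F_def by measurable
    have "emeasure (distr M (N1 \<Otimes>\<^sub>M N2) (\<lambda>\<omega>. (Z \<omega>, Y \<omega>))) R
        = (\<Sum>i. emeasure (distr M (N1 \<Otimes>\<^sub>M N2) (\<lambda>\<omega>. (Z \<omega>, Y \<omega>))) (H i \<times> A i))"
      unfolding RU by (intro suminf_emeasure[symmetric] disj) auto
    also have "\<dots> = (\<Sum>i. emeasure M (F i \<inter> D i))"
      by (intro suminf_cong, subst emeasure_distr)
         (auto intro!: arg_cong[of _ _ "emeasure M"] simp: D_def F_def)
    also have "\<dots> \<le> (\<Sum>i. emeasure M (F i) * emeasure M (D i) + (\<integral>\<^sup>+\<omega>. g \<omega> * indicator (D i) \<omega> \<partial>M))"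
      by (intro suminf_le dom) (auto simp: D_def F_def intro: ZE YE)
    also have "\<dots> = (\<Sum>i. emeasure M (F i) * emeasure M (D i)) + (\<Sum>i. \<integral>\<^sup>+\<omega>. g \<omega> * indicator (D i) \<omega> \<partial>M)"
      by (intro suminf_add[symmetric]) auto
    also have "(\<Sum>i. emeasure M (F i) * emeasure M (D i))
        = (\<Sum>i. emeasure (distr M N1 Z \<Otimes>\<^sub>M distr M N2 Y) (H i \<times> A i))"
      by (intro suminf_cong, subst Y.emeasure_pair_measure_Times)
         (auto simp: emeasure_distr D_def F_def mult.commute)
    also have "\<dots> = emeasure (distr M N1 Z \<Otimes>\<^sub>M distr M N2 Y) R"
      unfolding RU by (intro suminf_emeasure disj) auto
    also have "(\<Sum>i. \<integral>\<^sup>+\<omega>. g \<omega> * indicator (D i) \<omega> \<partial>M) = (\<integral>\<^sup>+\<omega>. (\<Sum>i. g \<omega> * indicator (D i) \<omega>) \<partial>M)"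
      by (intro nn_integral_suminf[symmetric]) auto
    \<comment> \<open>Exactly one label occurs at each point, namely
      \<open>h (Z \<omega>)\<close>.\<close>
    also have "\<dots> = (\<integral>\<^sup>+\<omega>. g \<omega> \<partial>M)"
    proof (intro nn_integral_cong)
      fix \<omega> assume \<omega>: "\<omega> \<in> space M"
      have "(\<Sum>i. g \<omega> * indicator (D i) \<omega>) = (\<Sum>i. g \<omega> * (if i = h (Z \<omega>) then 1 else 0))"
        by (intro suminf_cong arg_cong2[where f="(*)"] refl)
           (use \<omega> measurable_space[OF Z \<omega>] in \<open>auto simp: D_def H_def indicator_def\<close>)
      also have "\<dots> = g \<omega>"
        using sums_single[of "h (Z \<omega>)" "\<lambda>_. g \<omega>"] by (simp add: sums_iff if_distrib cong: if_cong)
      finally show "(\<Sum>i. g \<omega> * indicator (D i) \<omega>) = g \<omega>" .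
    qed
    finally show "emeasure (distr M (N1 \<Otimes>\<^sub>M N2) (\<lambda>\<omega>. (Z \<omega>, Y \<omega>))) R
        \<le> emeasure (distr M N1 Z \<Otimes>\<^sub>M distr M N2 Y) R + beta_mixing M E1 E2"
      by (simp add: beta)
  qed
qed

section \<open>Decoupling a separated block\<close>

lemma space_generated_sigma [simp]: "space (generated_sigma M X I) = space M"
  unfolding generated_sigma_def by (intro space_measure_of) auto

lemma measurable_generated_sigma:
  "k \<in> I \<Longrightarrow> X k \<in> measurable (generated_sigma M X I) borel"
  unfolding generated_sigma_def
  by (intro measurableI) (auto simp: sets_measure_of space_measure_of_conv intro!: sigma_sets.Basic)

lemma subalgebra_generated_sigma:
  assumes "\<And>k. k \<in> I \<Longrightarrow> X k \<in> borel_measurable M"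
  shows "subalgebra M (generated_sigma M X I)"
  unfolding subalgebra_def
proof (intro conjI)
  have "sets (generated_sigma M X I)
      = sigma_sets (space M) {X k -` A \<inter> space M |k A. k \<in> I \<and> A \<in> sets borel}"
    unfolding generated_sigma_def by (intro sets_measure_of) auto
  also have "\<dots> \<subseteq> sets M"
    using assms by (intro sets.sigma_sets_subset) (auto intro: measurable_sets)
  finally show "sets (generated_sigma M X I) \<subseteq> sets M" .
qed simp

text \<open>The induction adds the largest index last. Conditioning is on \<open>X b\<close> alone,
  since \<open>beta_coeff\<close> pairs the past with a single later variable, and the earlier part
  of the block depends only on indices up to \<open>b - m\<close>. Every index is charged one
  coefficient, also the smallest, before which the block is empty.\<close>

lemma block_law_le_product_add_beta:
  fixes X :: "nat \<Rightarrow> 'w \<Rightarrow> 'a::topological_space"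
  assumes M: "prob_space M" and X: "\<And>k. k \<ge> 1 \<Longrightarrow> X k \<in> borel_measurable M"
    and J: "finite J" "J \<subseteq> {1..}" and sep: "\<And>i j. i \<in> J \<Longrightarrow> j \<in> J \<Longrightarrow> i < j \<Longrightarrow> i + m \<le> j"
    and Q: "Q \<in> sets (\<Pi>\<^sub>M k\<in>J. (borel :: 'a measure))"
  shows "emeasure (distr M (\<Pi>\<^sub>M k\<in>J. borel) (\<lambda>\<omega>. \<lambda>k\<in>J. X k \<omega>)) Q
           \<le> emeasure (\<Pi>\<^sub>M k\<in>J. distr M borel (X k)) Q + of_nat (card J) * beta_coeff M X m"
  using J sep Q
proof (induction J arbitrary: Q rule: finite_linorder_max_induct)
  case empty
  interpret prob_space M by fact
  from empty(3) consider "Q = {}" | "Q = {\<lambda>k. undefined}"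
    by (auto simp: sets_PiM_empty)
  then show ?case
  proof cases
    case 2
    interpret E: prob_space "distr M (\<Pi>\<^sub>M k\<in>{}. borel :: 'a measure) (\<lambda>\<omega>. \<lambda>k\<in>{}. X k \<omega>)"
      by (rule prob_space_distr) (auto intro: measurable_restrict)
    show ?thesis using E.emeasure_le_1[of Q] unfolding 2 emeasure_PiM_empty
      by (simp only: card.empty of_nat_0 mult_zero_left add_0_right)
  qed simp
next
  case (insert b A)
  interpret prob_space M by fact
  let ?N1 = "borel :: 'a measure" and ?N2 = "\<Pi>\<^sub>M k\<in>A. (borel :: 'a measure)"
  let ?N = "\<Pi>\<^sub>M k\<in>insert b A. (borel :: 'a measure)"
  let ?P = "\<lambda>k. distr M borel (X k)"
  define Y where "Y \<omega> = (\<lambda>k\<in>A. X k \<omega>)" for \<omega>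
  define \<phi> where "\<phi> = (\<lambda>(x :: 'a, y :: nat \<Rightarrow> 'a). y(b := x))"
  have ge1: "k \<ge> 1" if "k \<in> insert b A" for k using insert.prems(1) that by auto
  have b: "b \<notin> A" using insert.hyps(2) by auto
  have Xm[measurable]: "X k \<in> borel_measurable M" if "k \<in> insert b A" for k using X ge1[OF that] by auto
  have Xb[measurable]: "X b \<in> borel_measurable M" by (rule Xm) simp
  have Y[measurable]: "Y \<in> measurable M ?N2" unfolding Y_def by (intro measurable_restrict Xm) auto
  have \<phi>[measurable]: "\<phi> \<in> measurable (?N1 \<Otimes>\<^sub>M ?N2) ?N"
  proof -
    have "(\<lambda>p. (\<lambda>(f, y). f(b := y)) (snd p, fst p)) \<in> measurable (?N1 \<Otimes>\<^sub>M ?N2) ?N"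
      by (rule measurable_compose[OF _ measurable_add_dim]) simp
    then show ?thesis by (simp add: \<phi>_def case_prod_beta')
  qed
  define Q' where "Q' = \<phi> -` Q \<inter> space (?N1 \<Otimes>\<^sub>M ?N2)"
  have Q'[measurable]: "Q' \<in> sets (?N1 \<Otimes>\<^sub>M ?N2)"
    unfolding Q'_def using \<phi> insert.prems(3) by (rule measurable_sets)
  have prob_P: "prob_space (?P k)" if "k \<in> insert b A" for k by (rule prob_space_distr) (use Xm that in auto)
  interpret Y: prob_space "distr M ?N2 Y" by (rule prob_space_distr) fact
  interpret P: prob_space "Pi\<^sub>M A ?P" by (rule prob_space_PiM) (use prob_P in auto)
  interpret Pb: prob_space "?P b" by (rule prob_P) simp
  have sets_P: "sets (?P b \<Otimes>\<^sub>M Pi\<^sub>M A ?P) = sets (?N1 \<Otimes>\<^sub>M ?N2)"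
    by (intro sets_pair_measure_cong sets_PiM_cong) auto
  have sets_Y: "sets (?P b \<Otimes>\<^sub>M distr M ?N2 Y) = sets (?N1 \<Otimes>\<^sub>M ?N2)"
    by (intro sets_pair_measure_cong) auto
  have "beta_mixing M (generated_sigma M X {1..b - m}) (generated_sigma M X {b}) \<le> beta_coeff M X m"
    unfolding beta_coeff_def using ge1[of b] by (intro SUP_upper) auto
  note beta = this
  have "distr M ?N (\<lambda>\<omega>. \<lambda>k\<in>insert b A. X k \<omega>)
      = distr (distr M (?N1 \<Otimes>\<^sub>M ?N2) (\<lambda>\<omega>. (X b \<omega>, Y \<omega>))) ?N \<phi>"
    by (subst distr_distr)
       (use b in \<open>auto simp: \<phi>_def Y_def fun_eq_iff intro!: arg_cong[of _ _ "distr M ?N"]\<close>)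
  then have "emeasure (distr M ?N (\<lambda>\<omega>. \<lambda>k\<in>insert b A. X k \<omega>)) Q
      = emeasure (distr M (?N1 \<Otimes>\<^sub>M ?N2) (\<lambda>\<omega>. (X b \<omega>, Y \<omega>))) Q'"
    using insert.prems(3) by (simp add: emeasure_distr Q'_def)
  also have "\<dots> \<le> emeasure (?P b \<Otimes>\<^sub>M distr M ?N2 Y) Q'
      + beta_mixing M (generated_sigma M X {1..b - m}) (generated_sigma M X {b})"
  proof (rule joint_law_le_product_add_beta[OF M _ _ Xb Y])
    have "subalgebra M (generated_sigma M X {1..b - m})"
      by (rule subalgebra_generated_sigma) (use X in auto)
    then show "sets (generated_sigma M X {1..b - m}) \<subseteq> sets M" by (simp add: subalgebra_def)
    show "subalgebra M (generated_sigma M X {b})" by (rule subalgebra_generated_sigma) auto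
    show "X b -` B \<inter> space M \<in> sets (generated_sigma M X {b})" if "B \<in> sets borel" for B
      using measurable_sets[OF measurable_generated_sigma[of b "{b}" X M] that] by simp
    \<comment> \<open>From \<open>1 \<le> k\<close> and \<open>k + m \<le> b\<close> the truncated
      difference \<open>b - m\<close> is a true one and at least \<open>k\<close>.\<close>
    have A_le: "k \<in> {1..b - m}" if "k \<in> A" for k
      using insert.prems(2)[of k b] insert.hyps(2) ge1[of k] that by auto
    have Y': "Y \<in> measurable (generated_sigma M X {1..b - m}) ?N2"
      unfolding Y_def by (intro measurable_restrict measurable_generated_sigma A_le)
    show "Y -` B \<inter> space M \<in> sets (generated_sigma M X {1..b - m})" if "B \<in> sets ?N2" for B
      using measurable_sets[OF Y' that] by simp
  qed (rule Q')
  also have "emeasure (?P b \<Otimes>\<^sub>M distr M ?N2 Y) Q' = (\<integral>\<^sup>+x. emeasure (distr M ?N2 Y) (Pair x -` Q') \<partial>?P b)"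
    by (rule Y.emeasure_pair_measure_alt) (use sets_Y Q' in simp)
  \<comment> \<open>The induction hypothesis is applied to every section of \<open>Q'\<close>, hence
    its generality in \<open>Q\<close>; integration over a probability law preserves the additive
    error.\<close>
  also have "\<dots> \<le> (\<integral>\<^sup>+x. emeasure (Pi\<^sub>M A ?P) (Pair x -` Q') + of_nat (card A) * beta_coeff M X m \<partial>?P b)"
  proof (rule nn_integral_mono)
    fix x
    have "Pair x -` Q' \<in> sets ?N2" by (rule sets_Pair1[OF Q'])
    then show "emeasure (distr M ?N2 Y) (Pair x -` Q')
        \<le> emeasure (Pi\<^sub>M A ?P) (Pair x -` Q') + of_nat (card A) * beta_coeff M X m"
      unfolding Y_def by (intro insert.IH) (use insert.prems in auto)
  qed
  also have "\<dots> = emeasure (?P b \<Otimes>\<^sub>M Pi\<^sub>M A ?P) Q' + of_nat (card A) * beta_coeff M X m"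
  proof (subst nn_integral_add)
    show "(\<lambda>x. emeasure (Pi\<^sub>M A ?P) (Pair x -` Q')) \<in> borel_measurable (?P b)"
      by (rule P.measurable_emeasure_Pair) (use sets_P Q' in simp)
    show "(\<integral>\<^sup>+x. emeasure (Pi\<^sub>M A ?P) (Pair x -` Q') \<partial>?P b) + (\<integral>\<^sup>+x. of_nat (card A) * beta_coeff M X m \<partial>?P b)
        = emeasure (?P b \<Otimes>\<^sub>M Pi\<^sub>M A ?P) Q' + of_nat (card A) * beta_coeff M X m"
      by (subst P.emeasure_pair_measure_alt) (use sets_P Q' Pb.emeasure_space_1 in simp_all)
  qed simp
  also have "emeasure (?P b \<Otimes>\<^sub>M Pi\<^sub>M A ?P) Q' = emeasure (Pi\<^sub>M (insert b A) ?P) Q"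
  proof -
    have "distr (?P b \<Otimes>\<^sub>M Pi\<^sub>M A ?P) (Pi\<^sub>M (insert b A) ?P) \<phi> = Pi\<^sub>M (insert b A) ?P"
      unfolding \<phi>_def by (rule distr_pair_PiM_eq_PiM) (use prob_P in auto)
    moreover have "\<phi> \<in> measurable (?P b \<Otimes>\<^sub>M Pi\<^sub>M A ?P) (Pi\<^sub>M (insert b A) ?P)"
    proof -
      have "sets (Pi\<^sub>M (insert b A) ?P) = sets ?N" by (intro sets_PiM_cong) auto
      then show ?thesis using \<phi> by (simp cong: measurable_cong_sets add: measurable_cong_sets[OF sets_P])
    qed
    moreover have "Q \<in> sets (Pi\<^sub>M (insert b A) ?P)"
      using insert.prems(3) sets_PiM_cong[of "insert b A" "insert b A" ?P "\<lambda>_. borel"] by simp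
    moreover have "space (?P b \<Otimes>\<^sub>M Pi\<^sub>M A ?P) = space (?N1 \<Otimes>\<^sub>M ?N2)"
      by (rule sets_eq_imp_space_eq[OF sets_P])
    ultimately show ?thesis by (metis emeasure_distr Q'_def)
  qed
  finally have "emeasure (distr M ?N (\<lambda>\<omega>. \<lambda>k\<in>insert b A. X k \<omega>)) Q
      \<le> emeasure (Pi\<^sub>M (insert b A) ?P) Q + of_nat (card A) * beta_coeff M X m
        + beta_mixing M (generated_sigma M X {1..b - m}) (generated_sigma M X {b})"
    by (simp only: add_right_mono)
  also have "\<dots> \<le> emeasure (Pi\<^sub>M (insert b A) ?P) Q + of_nat (card A) * beta_coeff M X m + beta_coeff M X m"
    using beta by (intro add_left_mono)
  finally show ?case
    unfolding card_insert_disjoint[OF insert.hyps(1) b] of_nat_Suc distrib_right mult_1_left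
    by (simp only: ac_simps)
qed

section \<open>Random signs\<close>

text \<open>Half the left side is the exponential moment of a fair two-point variable with values
  \<open>(1 - e) * v\<close> and \<open>- v\<close>. Its spread is \<open>(2 - e) * v\<close>, so
  Hoeffding's variance term is at most \<open>v^2 / 2\<close>, which the negative mean
  \<open>- e * v / 2\<close> absorbs because \<open>v \<le> e\<close>.\<close>

lemma exp_add_exp_uminus_le_2:
  fixes e v :: real
  assumes "0 \<le> v" "v \<le> e" "e \<le> 1"
  shows "exp ((1 - e) * v) + exp (- v) \<le> 2"
proof (cases "v = 0")
  case False
  define h where "h = (2 - e) * v"
  have h: "h > 0" using False assms by (simp add: h_def)
  have "- h * (1/2) + ln (1 + 1/2 * (exp h - 1)) \<le> h\<^sup>2 / 8"
    by (rule Hoeffdings_lemma_aux) (use h in auto)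
  then have "ln ((1 + exp h) / 2) \<le> h / 2 + h\<^sup>2 / 8" by (simp add: field_simps)
  then have "(1 + exp h) / 2 \<le> exp (h / 2 + h\<^sup>2 / 8)"
    by (metis add_pos_pos exp_gt_zero exp_ln exp_le_cancel_iff half_gt_zero zero_less_one)
  then have "(2 * exp (- v)) * ((1 + exp h) / 2) \<le> (2 * exp (- v)) * exp (h / 2 + h\<^sup>2 / 8)"
    by (intro mult_left_mono) auto
  then have "exp (- v) * (1 + exp h) \<le> 2 * (exp (- v) * exp (h / 2 + h\<^sup>2 / 8))"
    by (simp add: mult_ac)
  also have "exp (- v) * exp (h / 2 + h\<^sup>2 / 8) = exp (v * (((2 - e)\<^sup>2 / 4 * v - e) / 2))"
    by (simp add: h_def power2_eq_square field_simps flip: exp_add)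
  also have "(2 - e)\<^sup>2 / 4 * v \<le> 1 * v"
    using assms by (intro mult_right_mono) (auto intro: power_mono[of "2 - e" 2 2, simplified])
  then have "exp (v * (((2 - e)\<^sup>2 / 4 * v - e) / 2)) \<le> exp 0"
    using assms by (simp only: exp_le_cancel_iff) (intro mult_nonneg_nonpos, auto)
  finally show ?thesis by (simp add: h_def distrib_left algebra_simps flip: exp_add)
qed auto

text \<open>Here and below a subset \<open>S\<close> of \<open>J\<close> encodes signs: \<open>+\<close> on \<open>S\<close> and \<open>-\<close> on \<open>J - S\<close>.\<close>

lemma card_sign_deviation_le:
  fixes g :: "'i \<Rightarrow> real"
  assumes J: "finite J" and g: "\<And>j. j \<in> J \<Longrightarrow> g j \<in> {0..B}" and "0 < B" and e: "0 < e" "e \<le> 1"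
  shows "real (card {S\<in>Pow J. (\<Sum>j\<in>S. (1 - e) * g j) - (\<Sum>j\<in>J-S. g j) \<ge> y})
           \<le> 2 ^ card J * exp (- (e / B) * y)"
proof -
  \<comment> \<open>With this parameter \<open>s * g j\<close> lies between 0 and \<open>e\<close>,
    as \<open>exp_add_exp_uminus_le_2\<close> requires.\<close>
  define s where "s = e / B"
  have s: "s > 0" using assms by (simp add: s_def)
  define Y where "Y S = (\<Sum>j\<in>S. (1 - e) * g j) - (\<Sum>j\<in>J-S. g j)" for S
  have "real (card {S\<in>Pow J. Y S \<ge> y}) = (\<Sum>S\<in>{S\<in>Pow J. Y S \<ge> y}. 1)" by simp
  also have "\<dots> \<le> (\<Sum>S\<in>{S\<in>Pow J. Y S \<ge> y}. exp (s * (Y S - y)))"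
    using s by (intro sum_mono) auto
  also have "\<dots> \<le> (\<Sum>S\<in>Pow J. exp (s * (Y S - y)))"
    using J by (intro sum_mono2) auto
  also have "\<dots> = exp (- s * y) * (\<Sum>S\<in>Pow J. exp (s * Y S))"
    by (simp add: sum_distrib_left right_diff_distrib flip: exp_add)
  also have "(\<Sum>S\<in>Pow J. exp (s * Y S))
      = (\<Sum>S\<in>Pow J. (\<Prod>j\<in>S. exp ((1 - e) * (s * g j))) * (\<Prod>j\<in>J-S. exp (- (s * g j))))"
  proof (intro sum.cong refl)
    fix S assume "S \<in> Pow J"
    then have "finite S" using J by (auto intro: finite_subset)
    then show "exp (s * Y S) = (\<Prod>j\<in>S. exp ((1 - e) * (s * g j))) * (\<Prod>j\<in>J-S. exp (- (s * g j)))"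
      using J by (simp add: Y_def right_diff_distrib sum_distrib_left sum_negf mult_ac
        flip: exp_sum exp_add)
  qed
  \<comment> \<open>Multiplying out the product lists all sign patterns; this factorization plays
    the role of independence of the signs.\<close>
  also have "\<dots> = (\<Prod>j\<in>J. exp ((1 - e) * (s * g j)) + exp (- (s * g j)))"
    by (rule prod_add[OF J, symmetric])
  also have "\<dots> \<le> (\<Prod>j\<in>J. 2)"
  proof (intro prod_mono conjI)
    fix j assume j: "j \<in> J"
    have "s * g j \<le> s * B" using g[OF j] s by (intro mult_left_mono) auto
    then show "exp ((1 - e) * (s * g j)) + exp (- (s * g j)) \<le> 2"
      using g[OF j] s e \<open>0 < B\<close> by (intro exp_add_exp_uminus_le_2) (auto simp: s_def)
  qed (simp add: add_nonneg_nonneg)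
  finally show ?thesis by (simp add: Y_def s_def mult_ac)
qed

text \<open>The two values of the sign. The distance keeps coefficient 1 even where \<open>f\<close>
  has weight \<open>1 + e\<close>: the surplus \<open>- e * f\<close> is nonpositive and dropped, so
  afterwards the negative terms have weight 1 only.\<close>

lemma signed_le_abs_diff:
  fixes f g e :: real
  assumes "0 \<le> f" "0 \<le> g" "0 < e" "e \<le> 1"
  shows "(1 - e) * f \<le> \<bar>f - g\<bar> + (1 - e) * g" and "- ((1 + e) * f) \<le> \<bar>f - g\<bar> - g"
proof -
  have "(1 - e) * (f - g) \<le> (1 - e) * \<bar>f - g\<bar>" using assms by (intro mult_left_mono) auto
  also have "\<dots> \<le> 1 * \<bar>f - g\<bar>" using assms by (intro mult_right_mono) auto
  finally show "(1 - e) * f \<le> \<bar>f - g\<bar> + (1 - e) * g" by (simp add: algebra_simps)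
  have "0 \<le> e * f" using assms by simp
  then show "- ((1 + e) * f) \<le> \<bar>f - g\<bar> - g" by (simp add: algebra_simps)
qed

text \<open>The data are frozen, so \<open>C\<close> consists of vectors of values and only the
  signs vary. A union bound over the cover leaves the count for a single vector; passing from
  \<open>f\<close> to its neighbour lowers the threshold from \<open>\<tau>\<close> to
  \<open>\<tau> - r\<close>.\<close>

lemma card_sup_sign_deviation_le:
  fixes C :: "('i \<Rightarrow> real) set"
  assumes J: "finite J" "J \<noteq> {}"
    and C: "\<And>f j. f \<in> C \<Longrightarrow> j \<in> J \<Longrightarrow> f j \<in> {0..B}" and "0 < B" and e: "0 < e" "e \<le> 1"
    and G: "finite G" "card G \<le> K"
    and cover: "\<And>f. f \<in> C \<Longrightarrow> \<exists>g\<in>G. (1 / real (card J)) * (\<Sum>j\<in>J. \<bar>f j - g j\<bar>) < r"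
  shows "real (card {S\<in>Pow J. \<exists>f\<in>C. (\<Sum>j\<in>S. (1 - e) * f j) - (\<Sum>j\<in>J-S. (1 + e) * f j) \<ge> real (card J) * \<tau>})
           \<le> real K * (2 ^ card J * exp (- (e / B) * (real (card J) * (\<tau> - r))))"
proof -
  define N where "N = real (card J)"
  have N: "N > 0" using J by (simp add: N_def card_gt_0_iff)
  \<comment> \<open>Cover elements are arbitrary vectors. Clipping them to \<open>{0..B}\<close>
    does not increase their distance to vectors with values in that range, and makes the count for
    single vectors applicable.\<close>
  define trunc where "trunc g = (\<lambda>j. max 0 (min B (g j)))" for g :: "'i \<Rightarrow> real"
  let ?E = "\<lambda>g. {S\<in>Pow J. (\<Sum>j\<in>S. (1 - e) * trunc g j) - (\<Sum>j\<in>J-S. trunc g j) \<ge> N * (\<tau> - r)}"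
  have "{S\<in>Pow J. \<exists>f\<in>C. (\<Sum>j\<in>S. (1 - e) * f j) - (\<Sum>j\<in>J-S. (1 + e) * f j) \<ge> N * \<tau>} \<subseteq> (\<Union>g\<in>G. ?E g)"
  proof safe
    fix S f assume S: "S \<subseteq> J" and f: "f \<in> C"
      and dev: "(\<Sum>j\<in>S. (1 - e) * f j) - (\<Sum>j\<in>J-S. (1 + e) * f j) \<ge> N * \<tau>"
    obtain g where g: "g \<in> G" and "(1 / N) * (\<Sum>j\<in>J. \<bar>f j - g j\<bar>) < r"
      using cover[OF f] by (auto simp: N_def)
    then have d: "(\<Sum>j\<in>J. \<bar>f j - g j\<bar>) \<le> N * r" using N by (simp add: field_simps)
    have "(\<Sum>j\<in>J. \<bar>f j - trunc g j\<bar>) \<le> (\<Sum>j\<in>J. \<bar>f j - g j\<bar>)"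
      using C[OF f] by (intro sum_mono) (fastforce simp: trunc_def max_def min_def)
    with d have d: "(\<Sum>j\<in>J. \<bar>f j - trunc g j\<bar>) \<le> N * r" by simp
    have fS: "finite S" using S J by (auto intro: finite_subset)
    have nn: "0 \<le> f j" "0 \<le> trunc g j" if "j \<in> J" for j
      using C[OF f that] by (auto simp: trunc_def)
    have "(\<Sum>j\<in>S. (1 - e) * f j) + (\<Sum>j\<in>J-S. - ((1 + e) * f j))
        \<le> (\<Sum>j\<in>S. \<bar>f j - trunc g j\<bar> + (1 - e) * trunc g j) + (\<Sum>j\<in>J-S. \<bar>f j - trunc g j\<bar> - trunc g j)"
      using S e nn by (intro add_mono sum_mono signed_le_abs_diff) auto
    also have "\<dots> = (\<Sum>j\<in>J. \<bar>f j - trunc g j\<bar>)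
        + ((\<Sum>j\<in>S. (1 - e) * trunc g j) - (\<Sum>j\<in>J-S. trunc g j))"
      using sum.subset_diff[OF S J(1), of "\<lambda>j. \<bar>f j - trunc g j\<bar>"]
      by (simp add: sum.distrib sum_subtractf)
    finally have "N * \<tau> \<le> N * r + ((\<Sum>j\<in>S. (1 - e) * trunc g j) - (\<Sum>j\<in>J-S. trunc g j))"
      using dev d by (simp add: sum_negf)
    then have "S \<in> ?E g" using S by (simp add: right_diff_distrib)
    then show "S \<in> (\<Union>g\<in>G. ?E g)" using g by blast
  qed
  then have "card {S\<in>Pow J. \<exists>f\<in>C. (\<Sum>j\<in>S. (1 - e) * f j) - (\<Sum>j\<in>J-S. (1 + e) * f j) \<ge> N * \<tau>}
      \<le> card (\<Union>g\<in>G. ?E g)"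
    using J G by (intro card_mono) auto
  also have "\<dots> \<le> (\<Sum>g\<in>G. card (?E g))" using G by (intro card_UN_le)
  finally have "real (card {S\<in>Pow J. \<exists>f\<in>C. (\<Sum>j\<in>S. (1 - e) * f j) - (\<Sum>j\<in>J-S. (1 + e) * f j) \<ge> N * \<tau>})
      \<le> (\<Sum>g\<in>G. real (card (?E g)))" by (simp flip: of_nat_sum)
  also have "\<dots> \<le> (\<Sum>g\<in>G. 2 ^ card J * exp (- (e / B) * (N * (\<tau> - r))))"
    by (intro sum_mono card_sign_deviation_le) (use J e \<open>0 < B\<close> in \<open>auto simp: trunc_def\<close>)
  also have "\<dots> = real (card G) * (2 ^ card J * exp (- (e / B) * (N * (\<tau> - r))))" by simp
  also have "\<dots> \<le> real K * (2 ^ card J * exp (- (e / B) * (N * (\<tau> - r))))"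
    using G by (intro mult_right_mono) auto
  finally show ?thesis by (simp add: N_def)
qed

text \<open>Here \<open>x\<close>, \<open>\<mu>\<close>, \<open>y\<close> stand for the sample
  average, the mean and the ghost average. Lowering the relative weight from
  \<open>\<epsilon>\<close> to \<open>(1 - 1 / c) * \<epsilon>\<close> frees
  \<open>\<epsilon> / c * (x + \<mu>)\<close>. As \<open>x \<ge> t\<close>, this pays for the new
  weight times the ghost error \<open>t / c\<close>, so only \<open>t / c\<close> itself is
  lost.\<close>

lemma symmetrization_margin:
  fixes x y \<mu> t c \<epsilon> :: real
  assumes "0 \<le> \<mu>" "0 < \<epsilon>" "\<epsilon> < 1" "1 < c" "0 < t"
    and dev: "(1 - \<epsilon>) * x - (1 + \<epsilon>) * \<mu> \<ge> t" and y: "y \<le> \<mu> + t / c"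
  shows "(1 - (1 - 1 / c) * \<epsilon>) * x - (1 + (1 - 1 / c) * \<epsilon>) * y \<ge> (1 - 1 / c) * t"
proof -
  define q where "q = 1 / c"
  have q: "0 < q" "q < 1" using assms by (auto simp: q_def)
  define e where "e = (1 - q) * \<epsilon>"
  have e: "0 < e" "e < 1" using q assms mult_strict_mono[of "1 - q" 1 \<epsilon> 1] by (auto simp: e_def)
  have x: "x \<ge> t"
  proof -
    have "t \<le> (1 - \<epsilon>) * x" using dev assms mult_nonneg_nonneg[of "1+\<epsilon>" \<mu>] by linarith
    moreover from this have "0 \<le> x" using assms by (meson diff_gt_0_iff_gt less_le_trans less_imp_le zero_less_mult_pos)
    then have "(1 - \<epsilon>) * x \<le> 1 * x" using assms by (intro mult_right_mono) auto
    ultimately show ?thesis by simp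
  qed
  have "(1 + e) * y \<le> (1 + e) * (\<mu> + q * t)"
    using y e by (intro mult_left_mono) (auto simp: q_def)
  then have "(1 - e) * x - (1 + e) * y \<ge> (1 - e) * x - (1 + e) * (\<mu> + q * t)" by simp
  moreover have "(1 - e) * x - (1 + e) * (\<mu> + q * t)
     = ((1 - \<epsilon>) * x - (1 + \<epsilon>) * \<mu>) + q * \<epsilon> * (x + \<mu>) - q * t - e * q * t"
    by (simp add: e_def algebra_simps)
  moreover have "e * q * t \<le> q * \<epsilon> * (x + \<mu>)"
  proof -
    have "(1 - q) * t \<le> 1 * t" using q assms by (intro mult_right_mono) auto
    then have "(1 - q) * t \<le> x + \<mu>" using x assms by linarith
    then have "(q * \<epsilon>) * ((1 - q) * t) \<le> (q * \<epsilon>) * (x + \<mu>)" using q assms by (intro mult_left_mono) auto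
    then show ?thesis by (simp add: e_def mult_ac)
  qed
  ultimately have "(1 - e) * x - (1 + e) * y \<ge> t - q * t" using dev by linarith
  then show ?thesis by (simp add: e_def q_def algebra_simps)
qed

section \<open>Symmetrization on product spaces\<close>

lemma measurable_interleave:
  "(\<lambda>(x, y). \<lambda>i\<in>J \<times> (UNIV :: bool set). if snd i then x (fst i) else y (fst i))
     \<in> measurable (Pi\<^sub>M J P \<Otimes>\<^sub>M Pi\<^sub>M J P) (Pi\<^sub>M (J \<times> UNIV) (\<lambda>i. P (fst i)))"
  unfolding case_prod_beta'
proof (rule measurable_restrict)
  fix i :: "'a \<times> bool" assume "i \<in> J \<times> UNIV"
  then have "(\<lambda>x. x (fst i)) \<in> measurable (Pi\<^sub>M J P) (P (fst i))"
    by (intro measurable_component_singleton) auto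
  note this[THEN measurable_compose[rotated], OF measurable_fst]
    this[THEN measurable_compose[rotated], OF measurable_snd]
  then show "(\<lambda>x. if snd i then fst x (fst i) else snd x (fst i))
      \<in> measurable (Pi\<^sub>M J P \<Otimes>\<^sub>M Pi\<^sub>M J P) (P (fst i))"
    by (cases "snd i") simp_all
qed

text \<open>Storing two samples as one family over \<open>J \<times> UNIV\<close> turns an exchange
  of coordinates into a reindexing of a product measure.\<close>

lemma prod_law_interleave:
  fixes P :: "'i \<Rightarrow> 'a measure"
  assumes J: "finite J" and P: "\<And>j. prob_space (P j)"
  defines "N \<equiv> Pi\<^sub>M J P" and "W \<equiv> Pi\<^sub>M (J \<times> (UNIV :: bool set)) (\<lambda>i. P (fst i))"
  shows "distr (N \<Otimes>\<^sub>M N) W (\<lambda>(x, y). \<lambda>i\<in>J \<times> UNIV. if snd i then x (fst i) else y (fst i)) = W"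
    (is "distr _ _ ?T = _")
proof -
  interpret P: product_prob_space P J using P
    by (intro product_prob_spaceI)
  interpret W: product_prob_space "\<lambda>i::'i \<times> bool. P (fst i)" "J \<times> UNIV" using P
    by (intro product_prob_spaceI)
  interpret N: prob_space N unfolding N_def by (rule prob_space_PiM) (use P in auto)
  have T[measurable]: "?T \<in> measurable (N \<Otimes>\<^sub>M N) W"
    unfolding W_def N_def by (rule measurable_interleave)
  have "distr (N \<Otimes>\<^sub>M N) W ?T = Pi\<^sub>M (J \<times> UNIV) (\<lambda>i. P (fst i))"
  proof (rule W.PiM_eqI)
    show "finite (J \<times> (UNIV :: bool set))" using J by simp
    show "sets (distr (N \<Otimes>\<^sub>M N) W ?T) = sets (Pi\<^sub>M (J \<times> UNIV) (\<lambda>i. P (fst i)))" by (simp add: W_def)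
    fix A :: "'i \<times> bool \<Rightarrow> 'a set" assume A: "\<And>i. i \<in> J \<times> UNIV \<Longrightarrow> A i \<in> sets (P (fst i))"
    have AJ: "A (j, b) \<in> sets (P j)" if "j \<in> J" for j b using A[of "(j, b)"] that by simp
    have AW: "Pi\<^sub>E (J \<times> UNIV) A \<in> sets W"
      unfolding W_def using J A by (intro sets_PiM_I_finite) auto
    have AN: "(\<Pi>\<^sub>E j\<in>J. A (j, b)) \<in> sets N" for b
      unfolding N_def using J AJ by (intro sets_PiM_I_finite) auto
    have "?T -` (Pi\<^sub>E (J \<times> UNIV) A) \<inter> space (N \<Otimes>\<^sub>M N) = (\<Pi>\<^sub>E j\<in>J. A (j, True)) \<times> (\<Pi>\<^sub>E j\<in>J. A (j, False))"
    proof -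
      have sub: "(\<Pi>\<^sub>E j\<in>J. A (j, b)) \<subseteq> space N" for b using AN by (rule sets.sets_into_space)
      have ext: "space N \<subseteq> extensional J" unfolding N_def space_PiM PiE_def by auto
      have mem: "x \<in> (\<Pi>\<^sub>E j\<in>J. A (j, b)) \<longleftrightarrow> x \<in> space N \<and> (\<forall>j\<in>J. x j \<in> A (j, b))" for x b
        using ext sub[of b] by (simp only: PiE_iff subset_iff) blast
      have "(x, y) \<in> ?T -` (Pi\<^sub>E (J \<times> UNIV) A) \<longleftrightarrow> (\<forall>j\<in>J. \<forall>b. (if b then x j else y j) \<in> A (j, b))" for x y
        by (simp add: PiE_iff)
      then have "(x, y) \<in> ?T -` (Pi\<^sub>E (J \<times> UNIV) A) \<longleftrightarrow> (\<forall>j\<in>J. x j \<in> A (j, True) \<and> y j \<in> A (j, False))" for x y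
        by (simp add: all_bool_eq)
      then have "(x, y) \<in> ?T -` (Pi\<^sub>E (J \<times> UNIV) A) \<inter> space (N \<Otimes>\<^sub>M N)
          \<longleftrightarrow> (x, y) \<in> (\<Pi>\<^sub>E j\<in>J. A (j, True)) \<times> (\<Pi>\<^sub>E j\<in>J. A (j, False))" for x y
        unfolding space_pair_measure Int_iff mem_Sigma_iff mem by blast
      then show ?thesis by (intro set_eqI) (simp only: split_paired_all)
    qed
    then have "emeasure (distr (N \<Otimes>\<^sub>M N) W ?T) (Pi\<^sub>E (J \<times> UNIV) A)
        = emeasure (N \<Otimes>\<^sub>M N) ((\<Pi>\<^sub>E j\<in>J. A (j, True)) \<times> (\<Pi>\<^sub>E j\<in>J. A (j, False)))"
      using AW by (simp add: emeasure_distr)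
    also have "\<dots> = emeasure N (\<Pi>\<^sub>E j\<in>J. A (j, True)) * emeasure N (\<Pi>\<^sub>E j\<in>J. A (j, False))"
      by (rule N.emeasure_pair_measure_Times) (rule AN)+
    also have "\<dots> = (\<Prod>j\<in>J. emeasure (P j) (A (j, True))) * (\<Prod>j\<in>J. emeasure (P j) (A (j, False)))"
      unfolding N_def using J AJ by (simp add: P.emeasure_PiM)
    also have "\<dots> = (\<Prod>j\<in>J. \<Prod>b\<in>UNIV. emeasure (P j) (A (j, b)))"
      by (simp add: UNIV_bool prod.distrib mult.commute)
    also have "\<dots> = (\<Prod>i\<in>J \<times> UNIV. emeasure (P (fst i)) (A i))"
      by (simp add: prod.cartesian_product case_prod_beta')
    finally show "emeasure (distr (N \<Otimes>\<^sub>M N) W ?T) (Pi\<^sub>E (J \<times> UNIV) A)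
        = (\<Prod>i\<in>J \<times> UNIV. emeasure (P (fst i)) (A i))" .
  qed
  then show ?thesis by (simp add: W_def)
qed

section \<open>One block of independent coordinates\<close>

locale bounded_product_class =
  fixes J :: "'i set" and P :: "'i \<Rightarrow> 'a measure" and C :: "('i \<Rightarrow> 'a \<Rightarrow> real) set" and B :: real
  assumes J: "finite J" "J \<noteq> {}"
    and P: "\<And>j. prob_space (P j)"
    and C: "countable C"
    and C_meas: "\<And>f j. f \<in> C \<Longrightarrow> j \<in> J \<Longrightarrow> f j \<in> borel_measurable (P j)"
    and C_bound: "\<And>f j x. f \<in> C \<Longrightarrow> j \<in> J \<Longrightarrow> f j x \<in> {0..B}"
    and B: "0 < B"
begin

abbreviation N where "N \<equiv> Pi\<^sub>M J P"

definition n where "n = real (card J)"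

lemma n_pos: "0 < n"
  using J by (simp add: n_def card_gt_0_iff)

sublocale PP: product_prob_space P J
  using P by (intro product_prob_spaceI)

sublocale NN: pair_prob_space N N ..

lemma coordinate_measurable [measurable]:
  "f \<in> C \<Longrightarrow> j \<in> J \<Longrightarrow> (\<lambda>x. f j (x j)) \<in> borel_measurable N"
  by (rule measurable_compose[where f = "\<lambda>x. x j" and g = "f j" and N = "P j"])
     (auto intro: C_meas)

lemma exists_in_class_sets:
  assumes "\<And>f. f \<in> C \<Longrightarrow> \<phi> f \<in> borel_measurable M"
  shows "{x \<in> space M. \<exists>f\<in>C. (y :: real) \<le> \<phi> f x} \<in> sets M"
proof -
  have "{x \<in> space M. \<exists>f\<in>C. y \<le> \<phi> f x} = (\<Union>f\<in>C. {x \<in> space M. y \<le> \<phi> f x})" by auto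
  also have "\<dots> \<in> sets M"
    using assms by (intro sets.countable_UN'' C borel_measurable_le) auto
  finally show ?thesis .
qed

lemma hoeffding_upper_tail:
  assumes f: "f \<in> C" and s: "0 \<le> s"
  shows "measure N {x \<in> space N. (\<Sum>j\<in>J. f j (x j)) \<ge> (\<Sum>j\<in>J. \<integral>z. f j z \<partial>P j) + n * s}
           \<le> exp (- 2 * n * s\<^sup>2 / B\<^sup>2)"
proof -
  \<comment> \<open>Under a product measure the vector of all coordinates is the identity map, so
    its law is the product of its marginals.\<close>
  have "PP.indep_vars P (\<lambda>j x. x j) J"
  proof (subst PP.indep_vars_iff_distr_eq_PiM'[OF J(2)])
    have "distr N N (\<lambda>x. \<lambda>j\<in>J. x j) = distr N N (\<lambda>x. x)"
      by (intro distr_cong) (auto simp: space_PiM PiE_restrict restrict_def fun_eq_iff PiE_def extensional_def)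
    also have "\<dots> = N" by simp
    also have "\<dots> = Pi\<^sub>M J (\<lambda>j. distr N (P j) (\<lambda>x. x j))"
      by (intro PiM_cong refl) (simp add: PP.PiM_component)
    finally show "distr N N (\<lambda>x. \<lambda>j\<in>J. x j) = Pi\<^sub>M J (\<lambda>j. distr N (P j) (\<lambda>x. x j))" .
  qed auto
  then have indep: "PP.indep_vars (\<lambda>_. borel) (\<lambda>j x. f j (x j)) J"
    by (rule PP.indep_vars_compose2) (use C_meas f in auto)
  interpret H: Hoeffding_ineq N J "\<lambda>j x. f j (x j)" "\<lambda>_. 0" "\<lambda>_. B" "\<Sum>j\<in>J. integral\<^sup>L N (\<lambda>x. f j (x j))"
    using J indep C_bound f by unfold_locales auto
  have mean: "integral\<^sup>L N (\<lambda>x. f j (x j)) = (\<integral>z. f j z \<partial>P j)" if j: "j \<in> J" for j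
  proof -
    have "(\<integral>z. f j z \<partial>P j) = (\<integral>z. f j z \<partial>distr N (P j) (\<lambda>x. x j))"
      using j by (simp add: PP.PiM_component)
    also have "\<dots> = integral\<^sup>L N (\<lambda>x. f j (x j))"
      using j C_meas[OF f j] by (intro integral_distr) auto
    finally show ?thesis by simp
  qed
  have "measure N {x \<in> space N. (\<Sum>j\<in>J. f j (x j)) \<ge> (\<Sum>j\<in>J. integral\<^sup>L N (\<lambda>x. f j (x j))) + n * s}
      \<le> exp (- 2 * (n * s)\<^sup>2 / (\<Sum>j\<in>J. (B - 0)\<^sup>2))"
    by (rule H.Hoeffding_ineq_ge) (use s n_pos B J in \<open>auto simp: card_gt_0_iff\<close>)
  also have "- 2 * (n * s)\<^sup>2 / (\<Sum>j\<in>J. (B - 0)\<^sup>2) = - 2 * n * s\<^sup>2 / B\<^sup>2"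
    using n_pos B by (simp add: n_def power2_eq_square field_simps)
  also have "(\<Sum>j\<in>J. integral\<^sup>L N (\<lambda>x. f j (x j))) = (\<Sum>j\<in>J. \<integral>z. f j z \<partial>P j)"
    by (intro sum.cong refl mean)
  finally show ?thesis .
qed

text \<open>By Fubini it suffices to bound the section of \<open>?Q\<close> at each \<open>x\<close>
  in \<open>?E\<close> from below. The deviating \<open>f\<close> is chosen from \<open>x\<close>
  alone, before the ghost sample is drawn, so Hoeffding's inequality is needed for one function and
  no union bound arises. The upper bound on \<open>\<gamma>\<close> says that its failure
  probability at level \<open>t / c\<close> is at most \<open>1 / \<gamma>\<close>.\<close>

lemma ghost_sample:
  assumes \<epsilon>: "0 < \<epsilon>" "\<epsilon> < 1" and c: "1 < c" and t: "0 < t"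
    and \<gamma>: "1 < \<gamma>" "\<gamma> \<le> exp (2 * n * (t / c)\<^sup>2 / B\<^sup>2)"
  defines "e \<equiv> (1 - 1 / c) * \<epsilon>"
  shows "(1 - 1 / \<gamma>) * measure N {x \<in> space N. \<exists>f\<in>C.
             n * t \<le> (1 - \<epsilon>) * (\<Sum>j\<in>J. f j (x j)) - (1 + \<epsilon>) * (\<Sum>j\<in>J. \<integral>z. f j z \<partial>P j)}
           \<le> measure (N \<Otimes>\<^sub>M N) {p \<in> space (N \<Otimes>\<^sub>M N). \<exists>f\<in>C.
             n * ((1 - 1 / c) * t) \<le> (1 - e) * (\<Sum>j\<in>J. f j (fst p j)) - (1 + e) * (\<Sum>j\<in>J. f j (snd p j))}"
    (is "_ * measure N ?E \<le> measure _ ?Q")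
proof -
  have coord: "(\<lambda>p. f j (fst p j)) \<in> borel_measurable (N \<Otimes>\<^sub>M N)" "(\<lambda>p. f j (snd p j)) \<in> borel_measurable (N \<Otimes>\<^sub>M N)"
    if "f \<in> C" "j \<in> J" for f j
    using measurable_compose[OF measurable_fst coordinate_measurable[OF that]]
      measurable_compose[OF measurable_snd coordinate_measurable[OF that]] by auto
  have E: "?E \<in> sets N"
    by (rule exists_in_class_sets)
       (intro borel_measurable_diff borel_measurable_times borel_measurable_const borel_measurable_sum coordinate_measurable)
  have Q: "?Q \<in> sets (N \<Otimes>\<^sub>M N)"
    by (rule exists_in_class_sets)
       (intro borel_measurable_diff borel_measurable_times borel_measurable_const borel_measurable_sum coord)
  have "ennreal (1 - 1 / \<gamma>) * indicator ?E x \<le> emeasure N (Pair x -` ?Q)" if x: "x \<in> space N" for x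
  proof (cases "x \<in> ?E")
    case True
    then obtain f where f: "f \<in> C"
      and dev: "n * t \<le> (1 - \<epsilon>) * (\<Sum>j\<in>J. f j (x j)) - (1 + \<epsilon>) * (\<Sum>j\<in>J. \<integral>z. f j z \<partial>P j)" by auto
    let ?\<mu> = "\<Sum>j\<in>J. \<integral>z. f j z \<partial>P j"
    let ?H = "{y \<in> space N. (\<Sum>j\<in>J. f j (y j)) \<ge> ?\<mu> + n * (t / c)}"
    have H: "?H \<in> sets N"
      by (intro borel_measurable_le borel_measurable_const borel_measurable_sum coordinate_measurable f)
    have \<mu>: "0 \<le> ?\<mu>"
      by (intro sum_nonneg integral_nonneg_AE) (use C_bound f in auto)
    have "measure N ?H \<le> exp (- (2 * n * (t / c)\<^sup>2 / B\<^sup>2))"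
      using hoeffding_upper_tail[OF f, of "t / c"] t c by simp
    also have "\<dots> \<le> 1 / \<gamma>"
      using \<gamma> by (simp add: exp_minus field_simps)
    finally have "1 - 1 / \<gamma> \<le> measure N (space N - ?H)"
      using H by (simp add: PP.prob_compl)
    also have "\<dots> \<le> measure N (Pair x -` ?Q)"
    proof (rule PP.finite_measure_mono)
      show "Pair x -` ?Q \<in> sets N" by (rule sets_Pair1[OF Q])
      show "space N - ?H \<subseteq> Pair x -` ?Q"
      proof
        fix y assume y: "y \<in> space N - ?H"
        then have "(\<Sum>j\<in>J. f j (y j)) / n \<le> ?\<mu> / n + t / c"
          using n_pos by (auto simp: field_simps)
        moreover have "t \<le> (1 - \<epsilon>) * ((\<Sum>j\<in>J. f j (x j)) / n) - (1 + \<epsilon>) * (?\<mu> / n)"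
          using divide_right_mono[OF dev, of n] n_pos by (simp add: diff_divide_distrib)
        moreover have "0 \<le> ?\<mu> / n" using \<mu> n_pos by simp
        ultimately have "(1 - 1 / c) * t \<le> (1 - e) * ((\<Sum>j\<in>J. f j (x j)) / n) - (1 + e) * ((\<Sum>j\<in>J. f j (y j)) / n)"
          unfolding e_def using \<epsilon> c t by (intro symmetrization_margin) auto
        also have "\<dots> = ((1 - e) * (\<Sum>j\<in>J. f j (x j)) - (1 + e) * (\<Sum>j\<in>J. f j (y j))) / n"
          by (simp add: diff_divide_distrib)
        finally have "n * ((1 - 1 / c) * t) \<le> (1 - e) * (\<Sum>j\<in>J. f j (x j)) - (1 + e) * (\<Sum>j\<in>J. f j (y j))"
          using n_pos by (simp add: pos_le_divide_eq mult.commute)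
        then show "y \<in> Pair x -` ?Q" using x y f by (auto simp: space_pair_measure)
      qed
    qed
    finally show ?thesis using True by (simp add: PP.emeasure_eq_measure)
  qed simp
  then have "(\<integral>\<^sup>+x. ennreal (1 - 1 / \<gamma>) * indicator ?E x \<partial>N) \<le> (\<integral>\<^sup>+x. emeasure N (Pair x -` ?Q) \<partial>N)"
    by (intro nn_integral_mono) auto
  also have "\<dots> = emeasure (N \<Otimes>\<^sub>M N) ?Q"
    by (rule PP.emeasure_pair_measure_alt[symmetric]) (rule Q)
  finally have "ennreal (1 - 1 / \<gamma>) * emeasure N ?E \<le> emeasure (N \<Otimes>\<^sub>M N) ?Q"
    using E by (simp add: nn_integral_cmult_indicator)
  then show ?thesis
    using \<gamma> by (simp add: PP.emeasure_eq_measure NN.emeasure_eq_measure flip: ennreal_mult)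
qed

text \<open>Each coordinate is weighted by its sign minus \<open>e\<close>: a random sign with
  downward drift.\<close>

definition signed_sum :: "real \<Rightarrow> 'i set \<Rightarrow> ('i \<Rightarrow> 'a \<Rightarrow> real) \<Rightarrow> ('i \<Rightarrow> 'a) \<Rightarrow> real" where
  "signed_sum e S f x = (\<Sum>j\<in>S. (1 - e) * f j (x j)) - (\<Sum>j\<in>J-S. (1 + e) * f j (x j))"

lemma signed_sum_measurable:
  assumes "f \<in> C" "S \<subseteq> J"
  shows "signed_sum e S f \<in> borel_measurable N"
  unfolding signed_sum_def[abs_def] using assms
  by (intro borel_measurable_diff borel_measurable_times borel_measurable_const borel_measurable_sum
        coordinate_measurable) auto

definition dev_set :: "real \<Rightarrow> real \<Rightarrow> 'i set \<Rightarrow> ('i \<Rightarrow> 'a) set" where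
  "dev_set e y S = {x \<in> space N. \<exists>f\<in>C. y \<le> signed_sum e S f x}"

lemma dev_set_sets: "S \<subseteq> J \<Longrightarrow> dev_set e y S \<in> sets N"
  unfolding dev_set_def by (intro exists_in_class_sets signed_sum_measurable)

text \<open>Exchanging the two samples at the coordinates outside \<open>S\<close> preserves the
  law. The exchanged expression is the signed sum of the first sample with signs \<open>S\<close>
  plus that of the second with signs \<open>J - S\<close>, for the same \<open>f\<close>; if the
  total reaches \<open>2 * y\<close>, one of the two reaches \<open>y\<close>.\<close>

lemma measure_symmetrized_le_dev_sets:
  assumes S: "S \<subseteq> J"
  shows "measure (N \<Otimes>\<^sub>M N) {p \<in> space (N \<Otimes>\<^sub>M N). \<exists>f\<in>C.
             2 * y \<le> (1 - e) * (\<Sum>j\<in>J. f j (fst p j)) - (1 + e) * (\<Sum>j\<in>J. f j (snd p j))}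
           \<le> measure N (dev_set e y S) + measure N (dev_set e y (J - S))"
    (is "measure _ ?Q \<le> _")
proof -
  define W where "W = Pi\<^sub>M (J \<times> (UNIV :: bool set)) (\<lambda>i. P (fst i))"
  let ?T = "\<lambda>(x, y). \<lambda>i\<in>J \<times> (UNIV :: bool set). if snd i then x (fst i) else y (fst i)"
  interpret W: prob_space W unfolding W_def by (rule prob_space_PiM) (rule P)
  have coordW: "(\<lambda>w. f j (w (j, b))) \<in> borel_measurable W" if "f \<in> C" "j \<in> J" for f j b
    by (rule measurable_compose[where f = "\<lambda>w. w (j, b)" and g = "f j" and N = "P j"])
       (use that C_meas measurable_component_singleton[of "(j, b)" "J \<times> UNIV" "\<lambda>i. P (fst i)"] in \<open>auto simp: W_def\<close>)
  define V where "V = {w \<in> space W. \<exists>f\<in>C.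
      2 * y \<le> (1 - e) * (\<Sum>j\<in>J. f j (w (j, True))) - (1 + e) * (\<Sum>j\<in>J. f j (w (j, False)))}"
  have V: "V \<in> sets W"
    unfolding V_def
    by (rule exists_in_class_sets)
       (intro borel_measurable_diff borel_measurable_times borel_measurable_const borel_measurable_sum coordW)
  have T_meas: "?T \<in> measurable (N \<Otimes>\<^sub>M N) W"
    unfolding W_def by (rule measurable_interleave)
  have "?T -` V \<inter> space (N \<Otimes>\<^sub>M N) = ?Q"
    using measurable_space[OF T_meas] by (auto simp: V_def case_prod_beta')
  then have "measure (N \<Otimes>\<^sub>M N) ?Q = measure (distr (N \<Otimes>\<^sub>M N) W ?T) V"
    using V T_meas by (simp add: measure_distr)
  also have "\<dots> = measure W V"
    unfolding W_def using prod_law_interleave[of J P] J P by simp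
  also have "\<dots> \<le> measure N (dev_set e y S) + measure N (dev_set e y (J - S))"
  proof -
    \<comment> \<open>The boolean is kept for coordinates in \<open>S\<close> and negated for the
      others.\<close>
    let ?\<pi> = "\<lambda>i. (fst i, snd i = (fst i \<in> S))"
    let ?R = "\<lambda>w. \<lambda>i\<in>J \<times> (UNIV :: bool set). w (?\<pi> i)"
    let ?X = "\<lambda>b w. \<lambda>j\<in>J. w (j, b)"
    have "inj_on ?\<pi> (J \<times> UNIV)" by (auto simp: inj_on_def)
    moreover have "?\<pi> \<in> J \<times> UNIV \<rightarrow> J \<times> UNIV" by auto
    ultimately have R: "distr W W ?R = W"
      using distr_PiM_reindex[of "J \<times> UNIV" "\<lambda>i. P (fst i)" ?\<pi> "J \<times> UNIV"] P
      by (simp add: W_def)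
    have R_meas: "?R \<in> measurable W W"
      unfolding W_def
    proof (rule measurable_restrict)
      fix i :: "'i \<times> bool" assume "i \<in> J \<times> UNIV"
      then show "(\<lambda>w. w (?\<pi> i)) \<in> measurable (Pi\<^sub>M (J \<times> UNIV) (\<lambda>i. P (fst i))) (P (fst i))"
        using measurable_component_singleton[of "?\<pi> i" "J \<times> UNIV" "\<lambda>i. P (fst i)"] by auto
    qed
    have X: "distr W N (?X b) = N" for b
      using distr_PiM_reindex[of "J \<times> UNIV" "\<lambda>i. P (fst i)" "\<lambda>j. (j, b)" J] P
      by (auto simp: W_def inj_on_def)
    have X_meas: "?X b \<in> measurable W N" for b
      unfolding W_def
    proof (rule measurable_restrict)
      fix j assume "j \<in> J"
      then show "(\<lambda>w. w (j, b)) \<in> measurable (Pi\<^sub>M (J \<times> UNIV) (\<lambda>i. P (fst i))) (P j)"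
        using measurable_component_singleton[of "(j, b)" "J \<times> UNIV" "\<lambda>i. P (fst i)"] by auto
    qed
    have X_sets: "?X b -` dev_set e y S' \<inter> space W \<in> sets W"
      and X_prob: "measure W (?X b -` dev_set e y S' \<inter> space W) = measure N (dev_set e y S')"
      if "S' \<subseteq> J" for b S'
      using X_meas[of b] dev_set_sets[OF that, of e y] X[of b]
      by (auto intro: measurable_sets simp flip: measure_distr)
    have fin: "finite S" using S J by (auto intro: finite_subset)
    have split: "(\<Sum>j\<in>J. h j) = (\<Sum>j\<in>S. h j) + (\<Sum>j\<in>J-S. h j)" for h :: "'i \<Rightarrow> real"
      using sum.subset_diff[OF S J(1), of h] by simp
    have "measure W V = measure (distr W W ?R) V" using R by simp
    also have "\<dots> = measure W (?R -` V \<inter> space W)" using R_meas V by (rule measure_distr)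
    also have "?R -` V \<inter> space W
        \<subseteq> (?X True -` dev_set e y S \<inter> space W) \<union> (?X False -` dev_set e y (J - S) \<inter> space W)"
    proof
      fix w assume w: "w \<in> ?R -` V \<inter> space W"
      then obtain f where f: "f \<in> C"
        and dev: "2 * y \<le> (1 - e) * (\<Sum>j\<in>J. f j (?R w (j, True))) - (1 + e) * (\<Sum>j\<in>J. f j (?R w (j, False)))"
        by (auto simp: V_def)
      have R_sum: "(\<Sum>j\<in>J. f j (?R w (j, b))) = (\<Sum>j\<in>S. f j (w (j, b))) + (\<Sum>j\<in>J-S. f j (w (j, \<not> b)))" for b
        unfolding split using S by (intro arg_cong2[where f = "(+)"] sum.cong) (auto simp: subset_iff)
      have "2 * y \<le> (1 - e) * ((\<Sum>j\<in>S. f j (w (j, True))) + (\<Sum>j\<in>J-S. f j (w (j, False))))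
          - (1 + e) * ((\<Sum>j\<in>S. f j (w (j, False))) + (\<Sum>j\<in>J-S. f j (w (j, True))))"
        using dev unfolding R_sum by simp
      also have "\<dots> = signed_sum e S f (?X True w) + signed_sum e (J - S) f (?X False w)"
      proof -
        have X_sum: "(\<Sum>j\<in>S. k * f j (?X b w j)) = k * (\<Sum>j\<in>S. f j (w (j, b)))"
          "(\<Sum>j\<in>J-S. k * f j (?X b w j)) = k * (\<Sum>j\<in>J-S. f j (w (j, b)))" for k b
          using S by (auto simp: sum_distrib_left subset_iff intro!: sum.cong)
        have JJ: "J - (J - S) = S" using S by auto
        show ?thesis unfolding signed_sum_def JJ X_sum by (simp add: algebra_simps)
      qed
      finally have "y \<le> signed_sum e S f (?X True w) \<or> y \<le> signed_sum e (J - S) f (?X False w)"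
        by linarith
      moreover have "?X b w \<in> space N" for b
        using measurable_space[OF X_meas] w by auto
      ultimately show "w \<in> (?X True -` dev_set e y S \<inter> space W) \<union> (?X False -` dev_set e y (J - S) \<inter> space W)"
        using w f unfolding dev_set_def by blast
    qed
    then have "measure W (?R -` V \<inter> space W)
        \<le> measure W ((?X True -` dev_set e y S \<inter> space W) \<union> (?X False -` dev_set e y (J - S) \<inter> space W))"
      by (rule W.finite_measure_mono) (intro sets.Un X_sets S Diff_subset)
    also have "\<dots> \<le> measure W (?X True -` dev_set e y S \<inter> space W) + measure W (?X False -` dev_set e y (J - S) \<inter> space W)"
      by (intro measure_Un_le X_sets S Diff_subset)
    finally show ?thesis using X_prob S by simp
  qed
  finally show ?thesis .
qed

text \<open>The exchange bound holds for every \<open>S\<close>, hence on average over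
  \<open>Pow J\<close>. Under the integral this average is, for frozen data, a count of sign
  patterns, so the cover may vary with the data while its size bound \<open>K\<close> may not. Two
  signed sums and the division by \<open>1 - 1 / \<gamma>\<close> produce the prefactor.\<close>

theorem prob_relative_deviation_le:
  assumes \<epsilon>: "0 < \<epsilon>" "\<epsilon> < 1" and c: "1 < c" and t: "0 < t"
    and \<gamma>: "1 < \<gamma>" "\<gamma> \<le> exp (2 * n * (t / c)\<^sup>2 / B\<^sup>2)"
    and cover: "\<And>x. x \<in> space N \<Longrightarrow> \<exists>G. finite G \<and> card G \<le> K \<and>
      (\<forall>f\<in>C. \<exists>g\<in>G. (1 / n) * (\<Sum>j\<in>J. \<bar>f j (x j) - g j\<bar>) < r)"
  shows "measure N {x \<in> space N. \<exists>f\<in>C.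
             n * t \<le> (1 - \<epsilon>) * (\<Sum>j\<in>J. f j (x j)) - (1 + \<epsilon>) * (\<Sum>j\<in>J. \<integral>z. f j z \<partial>P j)}
           \<le> 2 * \<gamma> / (\<gamma> - 1) * (real K * exp (- ((1 - 1 / c) * \<epsilon> / B) * (n * ((1 - 1 / c) * t / 2 - r))))"
    (is "measure N ?E \<le> _")
proof -
  define e where "e = (1 - 1 / c) * \<epsilon>"
  have e: "0 < e" "e \<le> 1"
    using \<epsilon> c mult_mono[of "1 - 1 / c" 1 \<epsilon> 1] by (auto simp: e_def)
  \<comment> \<open>Half of the symmetrized margin, since the two samples share it.\<close>
  define \<tau> where "\<tau> = (1 - 1 / c) * t / 2"
  define b where "b = real K * exp (- (e / B) * (n * (\<tau> - r)))"
  let ?Q = "{p \<in> space (N \<Otimes>\<^sub>M N). \<exists>f\<in>C.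
      2 * (n * \<tau>) \<le> (1 - e) * (\<Sum>j\<in>J. f j (fst p j)) - (1 + e) * (\<Sum>j\<in>J. f j (snd p j))}"
  have ghost: "(1 - 1 / \<gamma>) * measure N ?E \<le> measure (N \<Otimes>\<^sub>M N) ?Q"
    using ghost_sample[OF \<epsilon> c t \<gamma>] by (simp add: e_def \<tau>_def)
  let ?D = "\<lambda>S. dev_set e (n * \<tau>) S"
  have int: "integrable N (indicator (?D S) :: _ \<Rightarrow> real)" if "S \<in> Pow J" for S
    using that dev_set_sets[of S e "n * \<tau>"]
    by (intro integrable_real_indicator) (auto simp: PP.emeasure_eq_measure)
  have "(\<Sum>S\<in>Pow J. measure N (?D S)) = (\<Sum>S\<in>Pow J. \<integral>x. indicator (?D S) x \<partial>N)"
    by (intro sum.cong refl) (simp add: dev_set_sets)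
  also have "\<dots> = (\<integral>x. (\<Sum>S\<in>Pow J. indicator (?D S) x) \<partial>N)"
    by (rule Bochner_Integration.integral_sum[symmetric]) (rule int)
  also have "\<dots> \<le> (\<integral>x. 2 ^ card J * b \<partial>N)"
  proof (rule integral_mono)
    show "integrable N (\<lambda>x. \<Sum>S\<in>Pow J. indicator (?D S) x :: real)"
      by (rule Bochner_Integration.integrable_sum) (rule int)
    fix x assume x: "x \<in> space N"
    obtain G where G: "finite G" "card G \<le> K"
      and cov: "\<And>f. f \<in> C \<Longrightarrow> \<exists>g\<in>G. (1 / n) * (\<Sum>j\<in>J. \<bar>f j (x j) - g j\<bar>) < r"
      using cover[OF x] by blast
    have "(\<Sum>S\<in>Pow J. indicator (?D S) x :: real) = real (card {S\<in>Pow J. x \<in> ?D S})"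
      using J by (simp add: indicator_def sum.If_cases Int_def)
    also have "{S\<in>Pow J. x \<in> ?D S} = {S\<in>Pow J. \<exists>h\<in>(\<lambda>f j. f j (x j)) ` C.
        (\<Sum>j\<in>S. (1 - e) * h j) - (\<Sum>j\<in>J-S. (1 + e) * h j) \<ge> real (card J) * \<tau>}"
      using x by (auto simp: dev_set_def signed_sum_def n_def)
    also have "real (card \<dots>) \<le> real K * (2 ^ card J * exp (- (e / B) * (real (card J) * (\<tau> - r))))"
      by (rule card_sup_sign_deviation_le[OF J _ B e G])
         (use C_bound cov in \<open>auto simp: n_def\<close>)
    finally show "(\<Sum>S\<in>Pow J. indicator (?D S) x) \<le> 2 ^ card J * b"
      by (simp add: b_def n_def mult_ac)
  qed simp
  also have "\<dots> = 2 ^ card J * b" by (simp add: PP.P.prob_space)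
  finally have sum: "(\<Sum>S\<in>Pow J. measure N (?D S)) \<le> 2 ^ card J * b" .
  \<comment> \<open>Complementation permutes \<open>Pow J\<close>, so the second sample contributes
    as much as the first.\<close>
  have "(\<Sum>S\<in>Pow J. measure N (?D (J - S))) = (\<Sum>S\<in>Pow J. measure N (?D S))"
    by (rule sum.reindex_bij_witness[of _ "\<lambda>S. J - S" "\<lambda>S. J - S"]) (auto simp: double_diff)
  then have "(\<Sum>S\<in>Pow J. measure N (?D S) + measure N (?D (J - S))) \<le> 2 ^ card J * (2 * b)"
    using sum by (simp add: sum.distrib)
  moreover have "(\<Sum>S\<in>Pow J. measure (N \<Otimes>\<^sub>M N) ?Q)
      \<le> (\<Sum>S\<in>Pow J. measure N (?D S) + measure N (?D (J - S)))"
    by (intro sum_mono measure_symmetrized_le_dev_sets) auto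
  moreover have "(\<Sum>S\<in>Pow J. measure (N \<Otimes>\<^sub>M N) ?Q) = 2 ^ card J * measure (N \<Otimes>\<^sub>M N) ?Q"
    using J by (simp add: card_Pow)
  ultimately have "2 ^ card J * measure (N \<Otimes>\<^sub>M N) ?Q \<le> 2 ^ card J * (2 * b)"
    by linarith
  then have "measure (N \<Otimes>\<^sub>M N) ?Q \<le> 2 * b" by simp
  with ghost have "(1 - 1 / \<gamma>) * measure N ?E \<le> 2 * b" by simp
  then have "measure N ?E \<le> 2 * b / (1 - 1 / \<gamma>)"
    using \<gamma> by (simp add: pos_le_divide_eq mult.commute)
  also have "\<dots> = 2 * \<gamma> / (\<gamma> - 1) * b"
    using \<gamma> by (simp add: field_simps)
  finally show ?thesis by (simp add: b_def e_def \<tau>_def)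
qed

end

section \<open>Covering numbers and residue blocks\<close>

lemma Inf_enat_attained:
  fixes A :: "enat set"
  assumes "Inf A \<le> enat K"
  shows "\<exists>x\<in>A. x \<le> enat K"
proof -
  have "A \<noteq> {}" using assms by (auto simp: Inf_enat_def)
  then have "Inf A \<in> A" unfolding Inf_enat_def by (auto intro: LeastI)
  with assms show ?thesis by blast
qed

text \<open>Only values at the points \<open>z j\<close> enter the distance, so a cover by functions
  becomes a finite set of vectors. One \<open>K\<close> serves all \<open>z\<close> because the
  entropy estimate bounds the supremum over \<open>z\<close>.\<close>

lemma uniform_entropy_cover:
  assumes ent: "uniform_entropy_estimate n F lam"
    and J: "J \<noteq> {}" "J \<subseteq> {1..n}" and r: "0 < r" and lam: "lam (card J) r = ereal l"
  obtains K :: nat where "real K \<le> exp l"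
    and "\<And>z. z \<in> (\<Pi>\<^sub>E j\<in>J. UNIV) \<Longrightarrow> \<exists>G. finite G \<and> card G \<le> K \<and>
      (\<forall>f\<in>F. \<exists>g\<in>G. (1 / real (card J)) * (\<Sum>j\<in>J. \<bar>f j (z j) - g j\<bar>) < r)"
proof -
  define S where "S = (SUP z \<in> (\<Pi>\<^sub>E j\<in>J. UNIV). covering_number J r (restrict_class F J) z)"
  have le: "ln_enat S \<le> ereal l"
    using ent J r lam unfolding uniform_entropy_estimate_def S_def by metis
  then obtain K where K: "S = enat K" by (cases S) (auto simp: ln_enat_def)
  have K_le: "real K \<le> exp l"
  \<comment> \<open>\<open>K = 0\<close> means an empty class; its logarithm is minus infinity, not
    a real number.\<close>
  proof (cases "K = 0")
    case False
    then have "ln (real K) \<le> l" using le K by (simp add: ln_enat_def)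
    then have "exp (ln (real K)) \<le> exp l" by simp
    then show ?thesis using False by simp
  qed simp
  show thesis
  proof (rule that[OF K_le])
    fix z :: "nat \<Rightarrow> 'a" assume z: "z \<in> (\<Pi>\<^sub>E j\<in>J. UNIV)"
    have "covering_number J r (restrict_class F J) z \<le> enat K"
      unfolding K[symmetric] S_def using z by (rule SUP_upper)
    from Inf_enat_attained[OF this[unfolded covering_number_def]]
    obtain G where G: "finite G" "card G \<le> K"
      and cov: "\<And>f. f \<in> restrict_class F J \<Longrightarrow> \<exists>g\<in>G. emp_dist1 J z f g < r" by auto
    let ?G = "(\<lambda>g j. g j (z j)) ` G"
    have "\<exists>g\<in>?G. (1 / real (card J)) * (\<Sum>j\<in>J. \<bar>f j (z j) - g j\<bar>) < r" if "f \<in> F" for f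
    proof -
      have "restrict f J \<in> restrict_class F J" using that by (auto simp: restrict_class_def)
      from cov[OF this] obtain g where "g \<in> G" "emp_dist1 J z (restrict f J) g < r" by blast
      then show ?thesis by (auto simp: emp_dist1_def intro!: bexI[of _ g])
    qed
    moreover have "card ?G \<le> K" using card_image_le[OF G(1)] G(2) by (rule le_trans)
    ultimately show "\<exists>G. finite G \<and> card G \<le> K \<and>
      (\<forall>f\<in>F. \<exists>g\<in>G. (1 / real (card J)) * (\<Sum>j\<in>J. \<bar>f j (z j) - g j\<bar>) < r)"
      using G(1) by (intro exI[of _ ?G]) auto
  qed
qed

section \<open>Residue classes modulo m as separated blocks\<close>

definition residue_block :: "nat \<Rightarrow> nat \<Rightarrow> nat \<Rightarrow> nat set" where
  "residue_block n m i = {k \<in> {1..n}. (k - 1) mod m = i}"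

text \<open>The block is the progression \<open>i + 1, i + 1 + m, ...\<close> of length
  \<open>(n - i - 1) div m + 1\<close>. As \<open>i < m\<close>, the number \<open>n - i - 1\<close>
  lies between \<open>n - m\<close> and \<open>n\<close>, which leaves two possible
  quotients.\<close>

lemma card_residue_block:
  assumes "i < m" "m \<le> n"
  shows "card (residue_block n m i) \<in> {n div m, n div m + 1}"
proof -
  have m: "0 < m" using assms by simp
  have "residue_block n m i = (\<lambda>j. i + 1 + m * j) ` {..(n - i - 1) div m}"
  proof (intro set_eqI iffI)
    fix k assume k: "k \<in> residue_block n m i"
    define j where "j = (k - 1) div m"
    have "(k - 1) mod m = i" using k by (simp add: residue_block_def)
    then have "k - 1 = m * j + i" unfolding j_def using mult_div_mod_eq[of m "k - 1"] by metis
    then have kj: "k = i + 1 + m * j" using k by (auto simp: residue_block_def)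
    then have "m * j \<le> n - i - 1" using k by (auto simp: residue_block_def)
    then have "j \<le> (n - i - 1) div m" using m by (simp add: less_eq_div_iff_mult_less_eq mult.commute)
    then show "k \<in> (\<lambda>j. i + 1 + m * j) ` {..(n - i - 1) div m}" using kj by auto
  next
    fix k assume "k \<in> (\<lambda>j. i + 1 + m * j) ` {..(n - i - 1) div m}"
    then obtain j where j: "j \<le> (n - i - 1) div m" and k: "k = i + 1 + m * j" by auto
    have "m * j \<le> n - i - 1" using j m by (simp add: less_eq_div_iff_mult_less_eq mult.commute)
    then show "k \<in> residue_block n m i" using assms by (auto simp: residue_block_def k)
  qed
  moreover have "inj_on (\<lambda>j. i + 1 + m * j) {..(n - i - 1) div m}"
    using m by (auto simp: inj_on_def)
  ultimately have card: "card (residue_block n m i) = (n - i - 1) div m + 1"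
    by (simp add: card_image)
  have "n - i - 1 \<le> n" "n \<le> (n - i - 1) + m" using assms by auto
  then have "(n - i - 1) div m \<le> n div m" "n div m \<le> ((n - i - 1) + m) div m"
    by (intro div_le_mono; simp)+
  then show ?thesis using m card by auto
qed

lemma residue_block_separated:
  assumes "k \<in> residue_block n m i" "k' \<in> residue_block n m i" "k < k'"
  shows "k + m \<le> k'"
proof -
  have "(k' - 1) mod m = (k - 1) mod m" "k - 1 < k' - 1" using assms by (auto simp: residue_block_def)
  then have "m dvd (k' - 1) - (k - 1)" by (simp add: mod_eq_dvd_iff_nat)
  then have "m \<le> (k' - 1) - (k - 1)" using \<open>k - 1 < k' - 1\<close> by (intro dvd_imp_le) auto
  then show ?thesis using assms by (auto simp: residue_block_def)
qed

lemma sum_residue_blocks: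
  assumes "0 < m"
  shows "(\<Sum>i<m. \<Sum>k\<in>residue_block n m i. h k) = (\<Sum>k=1..n. h k)"
  unfolding residue_block_def by (rule sum.group) (use assms in auto)

text \<open>
  Hoeffding's bound \<open>exp (- \<gamma> / 2)\<close> is strictly below \<open>1 / \<gamma>\<close>; any factor above \<open>1 / exp 1\<close> in place
  of \<open>1 / 2\<close> suffices, which leaves room for the levels \<open>s < t\<close>.
\<close>

lemma le_exp_of_slack:
  fixes \<gamma> y :: real
  assumes "0 \<le> \<gamma>" "9 / 20 * \<gamma> \<le> y"
  shows "\<gamma> \<le> exp y"
proof -
  \<comment> \<open>\<open>(5 / 4)^4\<close> exceeds 2.4, and 2.4 suffices because
    \<open>2.4 * 9 / 20\<close> exceeds 1.\<close>
  have "(1 + 1 / 4) ^ 4 \<le> exp (1 / 4 :: real) ^ 4" by (intro power_mono exp_ge_add_one_self) auto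
  also have "\<dots> = exp 1" by (simp flip: exp_of_nat_mult)
  finally have e: "2.4 \<le> exp (1 :: real)" by (simp add: power4_eq_xxxx)
  have "\<gamma> \<le> 2.4 * y" using assms by simp
  also have "\<dots> \<le> exp 1 * y" using e assms by (intro mult_right_mono) auto
  also have "\<dots> \<le> exp 1 * exp (y - 1)" using exp_ge_add_one_self[of "y - 1"] by (intro mult_left_mono) auto
  finally show ?thesis by (simp flip: exp_add)
qed

text \<open>
  The supremum need not be attained, so members of the class only reach levels \<open>s < t\<close>. The cover
  radius stays tied to \<open>t\<close>, because the entropy estimate is not continuous in the radius.
\<close>

lemma block_deviation_le:
  fixes X :: "nat \<Rightarrow> 'w \<Rightarrow> 'a::topological_space" and C :: "(nat \<Rightarrow> 'a \<Rightarrow> real) set"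
  assumes M: "prob_space M" and X: "\<And>k. k \<ge> 1 \<Longrightarrow> X k \<in> borel_measurable M"
    and J: "J \<noteq> {}" "J \<subseteq> {1..n}" and sep: "\<And>i j. i \<in> J \<Longrightarrow> j \<in> J \<Longrightarrow> i < j \<Longrightarrow> i + m \<le> j"
    and B: "0 < B" and CF: "C \<subseteq> F" "countable C"
    and F: "F \<subseteq> (\<Pi>\<^sub>E k\<in>{1..n}. {g \<in> borel_measurable borel. \<forall>x. g x \<in> {0..B}})"
    and ent: "uniform_entropy_estimate n F lam"
    and \<epsilon>: "0 < \<epsilon>" "\<epsilon> < 1" and c: "1 < c" and \<gamma>: "1 < \<gamma>" and \<gamma>': "1 < \<gamma>'"
    and s: "0 < s" "\<gamma> \<le> exp (2 * real (card J) * (s / c)\<^sup>2 / B\<^sup>2)"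
    and t: "0 < t" "s \<le> t"
  shows "emeasure M {\<omega> \<in> space M. \<exists>f\<in>C. real (card J) * s
             \<le> (1 - \<epsilon>) * (\<Sum>k\<in>J. f k (X k \<omega>)) - (1 + \<epsilon>) * (\<Sum>k\<in>J. \<integral>x. f k x \<partial>distr M borel (X k))}
           \<le> ennreal (exp (\<epsilon> * real n / B * (t - s))) * L_bound n B lam c \<gamma> \<gamma>' \<epsilon> (card J) t
             + of_nat (card J) * beta_coeff M X m"
    (is "emeasure M ?E \<le> ennreal ?x * ?L + ?b")
proof -
  interpret M: prob_space M by fact
  define a where "a = 1 - 1 / c"
  define r where "r = 1 / 2 * u1 c \<gamma>' * t"
  have a: "0 < a" "a \<le> 1" using c by (auto simp: a_def)
  have r: "0 < r" using c \<gamma>' t by (simp add: r_def u1_def)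
  have finJ: "finite J" using J by (auto intro: finite_subset)
  have "1 \<le> card J" using J finJ by (simp add: Suc_le_eq card_gt_0_iff)
  have card_le: "card J \<le> n" using card_mono[OF _ J(2)] by simp
  have lam_ge: "1 \<le> lam (card J) r"
    using ent \<open>1 \<le> card J\<close> r unfolding uniform_entropy_estimate_def by blast
  \<comment> \<open>Since \<open>card J \<le> n\<close>, the convention for the index
    \<open>n + 1\<close> does not intervene.\<close>
  have L: "?L = ennreal (2 * \<gamma> / (\<gamma> - 1)) *
      exp_ereal (ereal (- (1 / (2 * B)) * u2 c \<gamma>' * \<epsilon> * real (card J) * t) + lam (card J) r)"
    using card_le by (simp add: L_bound_def Let_def r_def)
  show ?thesis
  proof (cases "lam (card J) r")
    \<comment> \<open>Infinite entropy makes \<open>?L\<close> infinite, as its prefactor is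
      positive, and the bound is trivial.\<close>
    case PInf
    then have "?L = \<infinity>"
      using \<gamma> by (simp add: L exp_ereal_def ennreal_mult_top)
    then show ?thesis by (simp add: ennreal_mult_top)
  next
    case MInf
    then show ?thesis using lam_ge by simp
  next
    case (real l)
    obtain K :: nat where K: "real K \<le> exp l"
      and cover: "\<And>z. z \<in> (\<Pi>\<^sub>E j\<in>J. UNIV) \<Longrightarrow> \<exists>G. finite G \<and> card G \<le> K \<and>
        (\<forall>f\<in>F. \<exists>g\<in>G. (1 / real (card J)) * (\<Sum>j\<in>J. \<bar>f j (z j) - g j\<bar>) < r)"
      using uniform_entropy_cover[OF ent J r real] by metis
    \<comment> \<open>The locale asks for a probability law at every index, whereas
      \<open>X 0\<close> is unconstrained; \<open>max 1 j\<close> avoids it and changes nothing on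
      \<open>J\<close>.\<close>
    define P where "P j = distr M borel (X (max 1 j))" for j
    have P_J: "P j = distr M borel (X j)" if "j \<in> J" for j
      using J that by (auto simp: P_def max_def)
    have C_props: "f j \<in> borel_measurable borel" "f j x \<in> {0..B}" if "f \<in> C" "j \<in> J" for f j x
    proof -
      have "f j \<in> {g \<in> borel_measurable borel. \<forall>x. g x \<in> {0..B}}"
        using that CF F J by (auto simp: PiE_iff subset_iff)
      then show "f j \<in> borel_measurable borel" "f j x \<in> {0..B}" by auto
    qed
    interpret bp: bounded_product_class J P C B
    proof (rule bounded_product_class.intro)
      show "prob_space (P j)" for j
        unfolding P_def by (intro M.prob_space_distr X) auto
      show "f j \<in> borel_measurable (P j)" if "f \<in> C" "j \<in> J" for f j
        using C_props(1)[OF that] by (simp add: P_def)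
    qed (use finJ J CF B C_props in auto)
    let ?N = "Pi\<^sub>M J P"
    have n: "bp.n = real (card J)" by (simp add: bp.n_def)
    let ?D = "{x \<in> space ?N. \<exists>f\<in>C. bp.n * s \<le> (1 - \<epsilon>) * (\<Sum>j\<in>J. f j (x j)) - (1 + \<epsilon>) * (\<Sum>j\<in>J. \<integral>z. f j z \<partial>P j)}"
    have D: "?D \<in> sets ?N"
      by (rule bp.exists_in_class_sets)
         (intro borel_measurable_diff borel_measurable_times borel_measurable_const borel_measurable_sum bp.coordinate_measurable)
    have sets_N: "sets ?N = sets (\<Pi>\<^sub>M k\<in>J. (borel :: 'a measure))"
      by (intro sets_PiM_cong refl) (simp add: P_def)
    have space_N: "space ?N = (\<Pi>\<^sub>E j\<in>J. UNIV)"
      by (simp add: space_PiM P_def)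
    have "measure ?N ?D \<le> 2 * \<gamma> / (\<gamma> - 1) *
        (real K * exp (- ((1 - 1 / c) * \<epsilon> / B) * (bp.n * ((1 - 1 / c) * s / 2 - r))))"
    proof (rule bp.prob_relative_deviation_le[OF \<epsilon> c s(1) \<gamma>])
      show "\<gamma> \<le> exp (2 * bp.n * (s / c)\<^sup>2 / B\<^sup>2)" using s(2) by (simp add: n)
      fix x assume "x \<in> space ?N"
      then obtain G where "finite G" "card G \<le> K"
        "\<forall>f\<in>F. \<exists>g\<in>G. (1 / real (card J)) * (\<Sum>j\<in>J. \<bar>f j (x j) - g j\<bar>) < r"
        using cover[of x] unfolding space_N by blast
      then show "\<exists>G. finite G \<and> card G \<le> K \<and> (\<forall>f\<in>C. \<exists>g\<in>G. (1 / bp.n) * (\<Sum>j\<in>J. \<bar>f j (x j) - g j\<bar>) < r)"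
        unfolding n using CF(1) by (intro exI[of _ G]) blast
    qed
    also have "\<dots> \<le> 2 * \<gamma> / (\<gamma> - 1) * (?x * exp (- (1 / (2 * B)) * u2 c \<gamma>' * \<epsilon> * real (card J) * t + l))"
    proof (intro mult_left_mono)
      \<comment> \<open>The exponent lost by reaching only level \<open>s\<close> is bounded by a
        quantity independent of the block.\<close>
      have "(a * \<epsilon> / B) * (real (card J) * (a * (t - s) / 2)) = (a * a / 2) * (real (card J) * (\<epsilon> / B * (t - s)))"
        by (simp add: mult_ac)
      also have "\<dots> \<le> 1 * (real n * (\<epsilon> / B * (t - s)))"
        using a \<epsilon> B t card_le mult_mono[of a 1 a 1] by (intro mult_mono) auto
      finally have shift: "(a * \<epsilon> / B) * (real (card J) * (a * (t - s) / 2)) \<le> \<epsilon> * real n / B * (t - s)"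
        by (simp add: mult_ac)
      \<comment> \<open>As \<open>r = a * t / (2 * \<gamma>')\<close>, the margin
        \<open>a * t / 2 - r\<close> equals \<open>a * t / 2 * (1 - 1 / \<gamma>')\<close>; the
        further factor \<open>a\<close> in the exponent yields \<open>u2\<close>.\<close>
      have "- (a * \<epsilon> / B) * (real (card J) * (a * s / 2 - r))
          = (a * \<epsilon> / B) * (real (card J) * (a * (t - s) / 2)) - (1 / (2 * B)) * u2 c \<gamma>' * \<epsilon> * real (card J) * t"
        unfolding r_def u1_def u2_def a_def[symmetric] using B
        by (simp add: field_simps power2_eq_square)
      with shift have "- (a * \<epsilon> / B) * (real (card J) * (a * s / 2 - r))
          \<le> \<epsilon> * real n / B * (t - s) - (1 / (2 * B)) * u2 c \<gamma>' * \<epsilon> * real (card J) * t" by simp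
      then have "exp (- (a * \<epsilon> / B) * (real (card J) * (a * s / 2 - r)))
          \<le> exp (\<epsilon> * real n / B * (t - s) - (1 / (2 * B)) * u2 c \<gamma>' * \<epsilon> * real (card J) * t)"
        by (simp only: exp_le_cancel_iff)
      with K have "real K * exp (- (a * \<epsilon> / B) * (real (card J) * (a * s / 2 - r)))
          \<le> exp l * exp (\<epsilon> * real n / B * (t - s) - (1 / (2 * B)) * u2 c \<gamma>' * \<epsilon> * real (card J) * t)"
        by (intro mult_mono) auto
      then show "real K * exp (- ((1 - 1 / c) * \<epsilon> / B) * (bp.n * ((1 - 1 / c) * s / 2 - r)))
          \<le> ?x * exp (- (1 / (2 * B)) * u2 c \<gamma>' * \<epsilon> * real (card J) * t + l)"
        unfolding a_def[symmetric] n by (simp add: algebra_simps flip: exp_add)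
    qed (use \<gamma> in simp)
    finally have N_bound: "emeasure ?N ?D \<le> ennreal ?x * ?L"
      using \<gamma> by (simp add: bp.PP.emeasure_eq_measure L real exp_ereal_def mult_ac ennreal_leI flip: ennreal_mult)
    let ?Y = "\<lambda>\<omega>. \<lambda>k\<in>J. X k \<omega>"
    have Y: "?Y \<in> measurable M (\<Pi>\<^sub>M k\<in>J. (borel :: 'a measure))"
      using J by (intro measurable_restrict X) auto
    have "?E = ?Y -` ?D \<inter> space M"
    proof -
      have "(\<Sum>j\<in>J. \<integral>z. f j z \<partial>P j) = (\<Sum>k\<in>J. \<integral>x. f k x \<partial>distr M borel (X k))" for f :: "nat \<Rightarrow> 'a \<Rightarrow> real"
        by (intro sum.cong refl) (simp add: P_J)
      then show ?thesis by (auto simp: n space_N)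
    qed
    then have "emeasure M ?E = emeasure (distr M (\<Pi>\<^sub>M k\<in>J. borel) ?Y) ?D"
      using Y D sets_N by (simp add: emeasure_distr)
    also have "\<dots> \<le> emeasure (\<Pi>\<^sub>M k\<in>J. distr M borel (X k)) ?D + ?b"
      by (rule block_law_le_product_add_beta[OF M X finJ _ sep]) (use J D sets_N in auto)
    also have "(\<Pi>\<^sub>M k\<in>J. distr M borel (X k)) = ?N"
      by (intro PiM_cong refl) (simp add: P_J)
    finally show ?thesis using N_bound by (meson add_right_mono order_trans)
  qed
qed

section \<open>The deviation bound\<close>

text \<open>Removes the slack \<open>h = t - s\<close> by letting it tend to 0. For finite
  \<open>R\<close>, the case \<open>h = d\<close> shows that \<open>p\<close> is finite, so the
  limit can be taken in the reals.\<close>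

lemma ennreal_le_of_exp_slack:
  fixes p R :: ennreal
  assumes "0 < d" and le: "\<And>h. 0 < h \<Longrightarrow> h \<le> d \<Longrightarrow> p \<le> ennreal (exp (\<kappa> * h)) * R"
  shows "p \<le> R"
proof (cases R)
  case (real r)
  have "p \<le> ennreal (exp (\<kappa> * d) * r)" using le[of d] \<open>0 < d\<close> real by (simp add: ennreal_mult)
  then obtain p' where p': "p = ennreal p'" "0 \<le> p'" by (cases p) (auto simp: top_unique)
  have "p' \<le> exp (\<kappa> * h) * r" if "0 < h" "h \<le> d" for h
    using le[OF that] real p' by (simp flip: ennreal_mult)
  then have "eventually (\<lambda>h. p' \<le> exp (\<kappa> * h) * r) (at_right 0)"
    using \<open>0 < d\<close> by (auto simp: eventually_at_right_field intro!: exI[of _ d])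
  moreover have "((\<lambda>h. exp (\<kappa> * h) * r) \<longlongrightarrow> exp (\<kappa> * 0) * r) (at_right 0)"
    by (intro tendsto_intros)
  ultimately have "p' \<le> exp (\<kappa> * 0) * r" by (intro tendsto_lowerbound) auto
  then show ?thesis using real p' by (simp add: ennreal_leI)
qed simp

text \<open>Dominated convergence; it carries deviations of members of the class over to the
  countable approximating family.\<close>

lemma mean_avg_tendsto:
  fixes X :: "nat \<Rightarrow> 'w \<Rightarrow> 'a::topological_space"
  assumes M: "prob_space M" and X: "\<And>k. k \<ge> 1 \<Longrightarrow> X k \<in> borel_measurable M"
    and meas: "\<And>l k. k \<in> {1..n} \<Longrightarrow> g l k \<in> borel_measurable borel" "\<And>k. k \<in> {1..n} \<Longrightarrow> f k \<in> borel_measurable borel"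
    and bound: "\<And>l k x. k \<in> {1..n} \<Longrightarrow> \<bar>g l k x\<bar> \<le> B"
    and lim: "\<And>k x. k \<in> {1..n} \<Longrightarrow> (\<lambda>l. g l k x) \<longlonglongrightarrow> f k x"
  shows "(\<lambda>l. mean_avg M n X (g l)) \<longlonglongrightarrow> mean_avg M n X f"
  unfolding mean_avg_def
proof (intro tendsto_mult tendsto_const tendsto_sum)
  fix k assume k: "k \<in> {1..n}"
  interpret prob_space M by fact
  interpret D: prob_space "distr M borel (X k)" by (rule prob_space_distr) (use X k in auto)
  show "(\<lambda>l. \<integral>x. g l k x \<partial>distr M borel (X k)) \<longlonglongrightarrow> (\<integral>x. f k x \<partial>distr M borel (X k))"
    by (rule integral_dominated_convergence[where w = "\<lambda>_. B"]) (use meas bound lim k in auto)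
qed

theorem theorem3p6:
  fixes M :: "'w measure"
    and X :: "nat \<Rightarrow> 'w \<Rightarrow> real ^ 'd"
    and F :: "(nat \<Rightarrow> real ^ 'd \<Rightarrow> real) set"
    and lam :: "nat \<Rightarrow> real \<Rightarrow> ereal"
    and n m :: nat
    and B \<epsilon> c \<gamma> \<gamma>' t :: real
  assumes "prob_space M"
    and "\<And>k. k \<ge> 1 \<Longrightarrow> X k \<in> borel_measurable M"
    and "n \<ge> 1" and "B > 0"
    and "F \<subseteq> (\<Pi>\<^sub>E k\<in>{1..n}. {g \<in> borel_measurable borel. \<forall>x. g x \<in> {0..B}})"
    and "pointwise_measurable n F"
    and "uniform_entropy_estimate n F lam"
    and "\<epsilon> \<in> {0<..<1}" and "c > 1" and "\<gamma> > 1" and "\<gamma>' > 1"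
    and "m \<in> {1..n}"
    and "t \<ge> B * c / 2 * sqrt (\<gamma> / real (n div m))"
  shows "emeasure M {\<omega> \<in> space M.
            (SUP f\<in>F. ereal ((1 - \<epsilon>) * emp_avg n X f \<omega> - (1 + \<epsilon>) * mean_avg M n X f)) \<ge> ereal t}
         \<le> (of_nat m * max (L_bound n B lam c \<gamma> \<gamma>' \<epsilon> (n div m) t)
                           (L_bound n B lam c \<gamma> \<gamma>' \<epsilon> (n div m + 1) t)
             + of_nat n * beta_coeff M X m) * indicator {..2 * B} t"
proof -
  interpret prob_space M by fact
  note X = assms(2) and F = assms(5) and ent = assms(7)
  define val where "val f \<omega> = (1 - \<epsilon>) * emp_avg n X f \<omega> - (1 + \<epsilon>) * mean_avg M n X f" for f \<omega>
  define Ev where "Ev = {\<omega> \<in> space M. (SUP f\<in>F. ereal (val f \<omega>)) \<ge> ereal t}"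
  define Lmax where "Lmax = max (L_bound n B lam c \<gamma> \<gamma>' \<epsilon> (n div m) t) (L_bound n B lam c \<gamma> \<gamma>' \<epsilon> (n div m + 1) t)"
  define R where "R = of_nat m * Lmax + of_nat n * beta_coeff M X m"
  have n: "1 \<le> n" and B: "0 < B" and \<epsilon>: "0 < \<epsilon>" "\<epsilon> < 1" and c: "1 < c" and \<gamma>: "1 < \<gamma>" and \<gamma>': "1 < \<gamma>'"
    and m: "1 \<le> m" "m \<le> n" using assms by auto
  have q: "1 \<le> n div m" using m by (metis div_greater_zero_iff less_eq_Suc_le One_nat_def less_le_trans zero_less_one)
  have "0 < B * c / 2 * sqrt (\<gamma> / real (n div m))" using B c \<gamma> q by simp
  then have t: "0 < t" using assms(13) by linarith
  have F_props: "f k \<in> borel_measurable borel" "f k x \<in> {0..B}" if "f \<in> F" "k \<in> {1..n}" for f k x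
  proof -
    have "f k \<in> {g \<in> borel_measurable borel. \<forall>x. g x \<in> {0..B}}"
      using that F by (auto simp: PiE_iff subset_iff)
    then show "f k \<in> borel_measurable borel" "f k x \<in> {0..B}" by auto
  qed
  have "emeasure M Ev \<le> R * indicator {..2 * B} t"
  proof (cases "t \<le> 2 * B")
    case False
    \<comment> \<open>The mean is nonnegative and the sample average at most \<open>B\<close>, so
      for \<open>t > 2 * B\<close> the event is empty.\<close>
    have "val f \<omega> \<le> B" if f: "f \<in> F" for f \<omega>
    proof -
      have "0 \<le> mean_avg M n X f" unfolding mean_avg_def
        by (intro mult_nonneg_nonneg sum_nonneg integral_nonneg_AE) (use F_props(2)[OF f] in auto)
      moreover have emp: "0 \<le> emp_avg n X f \<omega>" unfolding emp_avg_def
        by (intro mult_nonneg_nonneg sum_nonneg) (use F_props(2)[OF f] in auto)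
      moreover have "emp_avg n X f \<omega> \<le> B"
      proof -
        have "(\<Sum>k=1..n. f k (X k \<omega>)) \<le> (\<Sum>k=1..n. B)"
          by (intro sum_mono) (use F_props(2)[OF f] in auto)
        then show ?thesis using n by (simp add: emp_avg_def field_simps)
      qed
      ultimately show ?thesis
        using \<epsilon> mult_right_mono[of "1 - \<epsilon>" 1 "emp_avg n X f \<omega>"] mult_nonneg_nonneg[of "1 + \<epsilon>" "mean_avg M n X f"]
        unfolding val_def by linarith
    qed
    then have "(SUP f\<in>F. ereal (val f \<omega>)) \<le> ereal B" for \<omega>
      by (intro SUP_least) simp
    also have "ereal B < ereal t" using False B by simp
    finally have "Ev = {}" unfolding Ev_def by (simp add: not_le)
    then show ?thesis by simp
  next
    case True
    obtain C where C: "countable C" "C \<subseteq> F"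
      and approx: "\<And>f. f \<in> F \<Longrightarrow> \<exists>s :: nat \<Rightarrow> nat \<Rightarrow> real ^ 'd \<Rightarrow> real. (\<forall>l. s l \<in> C) \<and>
          (\<forall>k\<in>{1..n}. \<forall>x. (\<lambda>l. s l k x) \<longlonglongrightarrow> f k x)"
      using assms(6) unfolding pointwise_measurable_def by blast
    let ?J = "residue_block n m"
    have J_sub: "?J i \<subseteq> {1..n}" for i by (auto simp: residue_block_def)
    have J_card: "card (?J i) \<in> {n div m, n div m + 1}" if "i < m" for i
      using that m by (intro card_residue_block) auto
    define E where "E s i = {\<omega> \<in> space M. \<exists>f\<in>C. real (card (?J i)) * s
      \<le> (1 - \<epsilon>) * (\<Sum>k\<in>?J i. f k (X k \<omega>)) - (1 + \<epsilon>) * (\<Sum>k\<in>?J i. \<integral>x. f k x \<partial>distr M borel (X k))}" for s i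
    have E_sets: "E s i \<in> sets M" for s i
    proof -
      have "(\<lambda>\<omega>. f k (X k \<omega>)) \<in> borel_measurable M" if "f \<in> C" "k \<in> ?J i" for f k
      proof (rule measurable_compose[of "X k" M borel "f k"])
        have k: "k \<in> {1..n}" using that J_sub by blast
        then show "X k \<in> borel_measurable M" by (intro X) simp
        show "f k \<in> borel_measurable borel" using that C k by (intro F_props(1)) auto
      qed
      then have "(\<Union>f\<in>C. {\<omega> \<in> space M. real (card (?J i)) * s
        \<le> (1 - \<epsilon>) * (\<Sum>k\<in>?J i. f k (X k \<omega>)) - (1 + \<epsilon>) * (\<Sum>k\<in>?J i. \<integral>x. f k x \<partial>distr M borel (X k))}) \<in> sets M"
        by (intro sets.countable_UN'' C borel_measurable_le borel_measurable_diff borel_measurable_times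
            borel_measurable_const borel_measurable_sum)
      also have "(\<Union>f\<in>C. {\<omega> \<in> space M. real (card (?J i)) * s
        \<le> (1 - \<epsilon>) * (\<Sum>k\<in>?J i. f k (X k \<omega>)) - (1 + \<epsilon>) * (\<Sum>k\<in>?J i. \<integral>x. f k x \<partial>distr M borel (X k))}) = E s i"
        by (auto simp: E_def)
      finally show ?thesis .
    qed
    \<comment> \<open>The limit \<open>t / 20\<close> on \<open>h\<close> keeps \<open>s^2\<close>
      above \<open>9 / 10 * t^2\<close>, since \<open>(19 / 20)^2 = 361 / 400\<close>.\<close>
    have slack: "emeasure M Ev \<le> ennreal (exp (\<epsilon> * real n / B * h)) * R" if h: "0 < h" "h \<le> 1 / 20 * t" for h
    proof -
      define s where "s = t - h"
      have s: "0 < s" "s < t" "19 / 20 * t \<le> s" using h t by (auto simp: s_def)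
      define x where "x = ennreal (exp (\<epsilon> * real n / B * (t - s)))"
      have x: "1 \<le> x"
        using s \<epsilon> B n by (simp add: x_def flip: ennreal_1)
      \<comment> \<open>A strict inequality at level \<open>s\<close> passes from the supremum to a
        member of \<open>F\<close> and, by convergence, to a member of \<open>C\<close>.\<close>
      have "Ev \<subseteq> (\<Union>i<m. E s i)"
      proof
        fix \<omega> assume \<omega>: "\<omega> \<in> Ev"
        then have "ereal s < (SUP f\<in>F. ereal (val f \<omega>))"
          using s by (auto simp: Ev_def intro: less_le_trans[of _ "ereal t"])
        then obtain f where f: "f \<in> F" "s < val f \<omega>" by (auto simp: less_SUP_iff)
        from approx[OF f(1)] obtain g where g: "\<And>l. g l \<in> C"
          and lim: "\<And>k x. k \<in> {1..n} \<Longrightarrow> (\<lambda>l. g l k x) \<longlonglongrightarrow> f k x" by blast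
        have gF: "g l \<in> F" for l using g C by auto
        have "(\<lambda>l. mean_avg M n X (g l)) \<longlonglongrightarrow> mean_avg M n X f"
          by (rule mean_avg_tendsto[where B = B, OF \<open>prob_space M\<close> X F_props(1)[OF gF] F_props(1)[OF f(1)] _ lim])
             (use F_props(2)[OF gF] in \<open>auto simp: abs_le_iff intro: order_trans[of _ 0]\<close>)
        moreover have "(\<lambda>l. emp_avg n X (g l) \<omega>) \<longlonglongrightarrow> emp_avg n X f \<omega>"
          unfolding emp_avg_def by (intro tendsto_intros lim)
        ultimately have "(\<lambda>l. val (g l) \<omega>) \<longlonglongrightarrow> val f \<omega>"
          unfolding val_def by (intro tendsto_intros)
        then have "eventually (\<lambda>l. s < val (g l) \<omega>) sequentially"
          using f(2) by (rule order_tendstoD)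
        then obtain l where l: "s < val (g l) \<omega>" by (auto simp: eventually_sequentially)
        define V where "V i = (1 - \<epsilon>) * (\<Sum>k\<in>?J i. g l k (X k \<omega>)) - (1 + \<epsilon>) * (\<Sum>k\<in>?J i. \<integral>x. g l k x \<partial>distr M borel (X k))" for i
        have blocks: "(\<Sum>i<m. \<Sum>k\<in>?J i. w k) = (\<Sum>k=1..n. w k)" for w :: "nat \<Rightarrow> real"
          using m by (intro sum_residue_blocks) simp
        have "(\<Sum>i<m. V i) = (1 - \<epsilon>) * (\<Sum>k=1..n. g l k (X k \<omega>)) - (1 + \<epsilon>) * (\<Sum>k=1..n. \<integral>x. g l k x \<partial>distr M borel (X k))"
          unfolding V_def sum_subtractf sum_distrib_left[symmetric] blocks ..
        also have "\<dots> = real n * val (g l) \<omega>"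
          using n by (simp add: val_def emp_avg_def mean_avg_def field_simps)
        finally have V_sum: "(\<Sum>i<m. V i) = real n * val (g l) \<omega>" .
        have "(\<Sum>i<m. real (card (?J i)) * s) = real n * s"
          using blocks[of "\<lambda>_. 1"] by (simp flip: sum_distrib_right)
        also have "\<dots> < (\<Sum>i<m. V i)" using l n by (simp add: V_sum)
        \<comment> \<open>Pigeonhole: the block deviations \<open>V i\<close> add up to more than
          the thresholds do, so some block exceeds its own.\<close>
        finally have "\<exists>i<m. real (card (?J i)) * s < V i"
          by (metis (no_types, lifting) lessThan_iff linorder_not_less sum_mono)
        then show "\<omega> \<in> (\<Union>i<m. E s i)"
          using g[of l] \<omega> by (force simp: E_def V_def Ev_def)
      qed
      \<comment> \<open>Monotonicity asks for measurability of the larger set, which the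
        countability of \<open>C\<close> provides.\<close>
      then have "emeasure M Ev \<le> emeasure M (\<Union>i<m. E s i)"
        by (rule emeasure_mono) (use E_sets in auto)
      also have "\<dots> \<le> (\<Sum>i<m. emeasure M (E s i))"
        by (rule emeasure_subadditive_finite) (use E_sets in auto)
      also have "\<dots> \<le> (\<Sum>i<m. x * Lmax + of_nat (card (?J i)) * beta_coeff M X m)"
      proof (rule sum_mono)
        fix i assume "i \<in> {..<m}"
        then have i: "i < m" by simp
        have Jq: "n div m \<le> card (?J i)" using J_card[OF i] by auto
        have J_ne: "?J i \<noteq> {}" using Jq q by auto
        \<comment> \<open>The squared assumption on \<open>t\<close> gives
          \<open>B^2 * c^2 * \<gamma> \<le> 4 * (n div m) * t^2\<close>; with
          \<open>s^2 \<ge> 9 / 10 * t^2\<close> the exponent is at least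
          \<open>2 * 9 / 10 / 4 = 9 / 20\<close> times \<open>\<gamma>\<close>.\<close>
        have "\<gamma> \<le> exp (2 * real (card (?J i)) * (s / c)\<^sup>2 / B\<^sup>2)"
        proof (rule le_exp_of_slack)
          have "(B * c / 2 * sqrt (\<gamma> / real (n div m)))\<^sup>2 \<le> t\<^sup>2"
            by (intro power_mono assms(13)) (use B c \<gamma> in auto)
          then have "B\<^sup>2 * c\<^sup>2 / 4 * (\<gamma> / real (n div m)) \<le> t\<^sup>2"
            using \<gamma> by (simp add: power_mult_distrib power_divide)
          then have t2: "B\<^sup>2 * c\<^sup>2 * \<gamma> \<le> 4 * real (n div m) * t\<^sup>2"
            using q by (simp add: field_simps)
          have "(19 / 20 * t)\<^sup>2 \<le> s\<^sup>2" using s t by (intro power_mono) auto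
          moreover have "(19 / 20 * t)\<^sup>2 = 361 / 400 * t\<^sup>2" by (simp add: power2_eq_square)
          ultimately have "9 / 10 * t\<^sup>2 \<le> s\<^sup>2" using zero_le_power2[of t] by linarith
          then have "real (n div m) * (9 / 10 * t\<^sup>2) \<le> real (card (?J i)) * s\<^sup>2"
            using Jq by (intro mult_mono) auto
          then have "9 / 20 * (B\<^sup>2 * c\<^sup>2 * \<gamma>) \<le> 2 * real (card (?J i)) * s\<^sup>2" using t2 by simp
          then show "9 / 20 * \<gamma> \<le> 2 * real (card (?J i)) * (s / c)\<^sup>2 / B\<^sup>2"
            using B c by (simp add: power_divide pos_le_divide_eq mult_ac)
        qed (use \<gamma> in simp)
        then have "emeasure M (E s i) \<le> x * L_bound n B lam c \<gamma> \<gamma>' \<epsilon> (card (?J i)) t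
            + of_nat (card (?J i)) * beta_coeff M X m"
          unfolding E_def x_def using s t
          by (intro block_deviation_le[OF \<open>prob_space M\<close> X J_ne J_sub residue_block_separated B C(2,1) F ent \<epsilon> c \<gamma> \<gamma>']) auto
        also have "\<dots> \<le> x * Lmax + of_nat (card (?J i)) * beta_coeff M X m"
          using J_card[OF i] by (intro add_right_mono mult_left_mono) (auto simp: Lmax_def)
        finally show "emeasure M (E s i) \<le> x * Lmax + of_nat (card (?J i)) * beta_coeff M X m" .
      qed
      also have "\<dots> = x * (of_nat m * Lmax) + of_nat (\<Sum>i<m. card (?J i)) * beta_coeff M X m"
        unfolding sum.distrib of_nat_sum sum_distrib_right by (simp add: mult_ac)
      also have "(\<Sum>i<m. card (?J i)) = n"
        using sum_residue_blocks[of m "\<lambda>_. 1 :: nat" n] m by simp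
      \<comment> \<open>Since \<open>x \<ge> 1\<close>, the mixing term may carry the slack factor
        too, so that the whole bound \<open>R\<close> is multiplied by it.\<close>
      also have "x * (of_nat m * Lmax) + of_nat n * beta_coeff M X m
          \<le> x * (of_nat m * Lmax) + x * (of_nat n * beta_coeff M X m)"
        using mult_right_mono[OF x, of "of_nat n * beta_coeff M X m"] by (intro add_left_mono) simp
      also have "\<dots> = x * R" by (simp add: R_def distrib_left)
      finally show ?thesis by (simp add: x_def s_def)
    qed
    have "emeasure M Ev \<le> R"
      by (rule ennreal_le_of_exp_slack[where d = "1 / 20 * t", OF _ slack]) (use t in simp_all)
    then show ?thesis using True by simp
  qed
  then show ?thesis by (simp add: Ev_def val_def R_def Lmax_def)
qed

end
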